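(* Let $n\ge1$. There is an isomorphism of associative algebras $$\phi_1:A_n\#U(\mathfrak g_n)\longrightarrow D_n\otimes U(\mathfrak m_{\mathbf 1,\mathbf 0}\Delta)$$ given by $$\phi_1(t^{\mathbf a}x^{\mathbf m}d_i)=\sum_{\mathbf r=\mathbf 0}^{\mathbf m}\binom{\mathbf m}{\mathbf r}t^{\mathbf a}x^{\mathbf m-\mathbf r}\otimes\bigl(t^{\mathbf a}x^{\mathbf r}d_i-\delta_{\mathbf r,\mathbf 0}d_i\bigr)+(t^{\mathbf a}x^{\mathbf m}\cdot d_i)\otimes1,$$ $$\phi_1(d_i)=d_i\otimes1,\qquad \phi_1(t^{\mathbf a}x^{\mathbf m})=t^{\mathbf a}x^{\mathbf m}\otimes1,$$ for all $\mathbf a\in\mathbb Z^n$, $\mathbf m\in\mathbb Z_{\ge0}^n$ and $1\le i\le n$.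
   Context: All vector spaces and algebras are over $\mathbb C$, and $\otimes=\otimes_{\mathbb C}$. For a positive integer $n$, $A_n=\mathbb C[t_1^{\pm1},\ldots,t_n^{\pm1},x_1,\ldots,x_n]$, $d_i=t_i\frac{\partial}{\partial t_i}+\frac{\partial}{\partial x_i}$, $\Delta=\mathrm{span}\{d_1,\ldots,d_n\}$, and $\mathfrak g_n=\bigoplus_{i=1}^nA_nd_i$, a Lie subalgebra of $\mathrm{Der}(A_n)$ with bracket $[fd_i,gd_j]=f\,d_i(g)d_j-g\,d_j(f)d_i$. We write $t^{\mathbf a}=t_1^{a_1}\cdots t_n^{a_n}$, $x^{\mathbf m}=x_1^{m_1}\cdots x_n^{m_n}$ and $\binom{\mathbf m}{\mathbf r}=\prod_j\binom{m_j}{r_j}$; the sum $\sum_{\mathbf r=\mathbf 0}^{\mathbf m}$ is over all $\mathbf r\in\mathbb Z_{\ge0}^n$ with $r_j\le m_j$ for all $j$; $\delta_{\mathbf r,\mathbf 0}$ is the Kronecker delta. $A_n\#U(\mathfrak g_n)$ is the smash product: as a vector space it is $A_n\otimes U(\mathfrak g_n)$, containing $A_n$ and $U(\mathfrak g_n)$ as subalgebras, with $X\cdot f=f\cdot X+X(f)$ for $X\in\mathfrak g_n$, $f\in A_n$. The dot denotes multiplication in the smash product, so the element $t^{\mathbf a}x^{\mathbf m}d_i\in\mathfrak g_n$ is distinguished from the product $t^{\mathbf a}x^{\mathbf m}\cdot d_i$ of $t^{\mathbf a}x^{\mathbf m}\in A_n$ with $d_i\in\mathfrak g_n$. $D_n$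 is the subalgebra of $A_n\#U(\mathfrak g_n)$ generated by $A_n$ and $d_1,\ldots,d_n$. $\mathfrak m_{\mathbf 1,\mathbf 0}$ is the maximal ideal of $A_n$ generated by $t_1-1,\ldots,t_n-1,x_1,\ldots,x_n$, and $\mathfrak m_{\mathbf 1,\mathbf 0}\Delta=\bigoplus_i\mathfrak m_{\mathbf 1,\mathbf 0}d_i$, a Lie subalgebra of $\mathfrak g_n$. *)

theory Defs
  imports
    Complex_Main
    "HOL-Library.Poly_Mapping"
    "HOL-Library.Function_Algebras"
    "HOL-Library.Product_Plus"
begin

section \<open>Complex vector spaces, associative algebras and Lie algebras\<close>

class scaleC =
  fixes scaleC :: "complex \<Rightarrow> 'a \<Rightarrow> 'a" (infixr \<open>*\<^sub>C\<close> 75)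

class complex_space = scaleC + ab_group_add +
  assumes scaleC_add_right: "c *\<^sub>C (x + y) = c *\<^sub>C x + c *\<^sub>C y"
    and scaleC_add_left: "(c + d) *\<^sub>C x = c *\<^sub>C x + d *\<^sub>C x"
    and scaleC_scaleC: "c *\<^sub>C (d *\<^sub>C x) = (c * d) *\<^sub>C x"
    and scaleC_one: "1 *\<^sub>C x = x"

class complex_algebra = complex_space + ring_1 +
  assumes mult_scaleC_left: "(c *\<^sub>C x) * y = c *\<^sub>C (x * y)"
    and mult_scaleC_right: "x * (c *\<^sub>C y) = c *\<^sub>C (x * y)"

class lie_algebra = complex_space +
  fixes lie :: "'a \<Rightarrow> 'a \<Rightarrow> 'a"
  assumes lie_add_left: "lie (x + y) z = lie x z + lie y z"
    and lie_add_right: "lie x (y + z) = lie x y + lie x z"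
    and lie_scaleC_left: "lie (c *\<^sub>C x) y = c *\<^sub>C lie x y"
    and lie_scaleC_right: "lie x (c *\<^sub>C y) = c *\<^sub>C lie x y"
    and lie_self: "lie x x = 0"
    and jacobi: "lie x (lie y z) = lie (lie x y) z + lie y (lie x z)"

global_interpretation cvs: vector_space "scaleC :: complex \<Rightarrow> 'a \<Rightarrow> 'a::complex_space"
  by unfold_locales (simp_all add: scaleC_add_right scaleC_add_left scaleC_scaleC scaleC_one)

abbreviation clinear :: "('a::complex_space \<Rightarrow> 'b::complex_space) \<Rightarrow> bool"
  where "clinear f \<equiv> Vector_Spaces.linear scaleC scaleC f"

definition algebra_iso :: "('a::complex_algebra \<Rightarrow> 'b::complex_algebra) \<Rightarrow> bool"
  where "algebra_iso f \<longleftrightarrow>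
    clinear f \<and> f 1 = 1 \<and> (\<forall>x y. f (x * y) = f x * f y) \<and> bij f"

definition subalgebra :: "'a::complex_algebra set \<Rightarrow> bool"
  where "subalgebra B \<longleftrightarrow> 1 \<in> B \<and>
    (\<forall>x\<in>B. \<forall>y\<in>B. x + y \<in> B \<and> x * y \<in> B) \<and> (\<forall>c. \<forall>x\<in>B. c *\<^sub>C x \<in> B)"

definition two_sided_ideal :: "'a::ring_1 set \<Rightarrow> bool"
  where "two_sided_ideal I \<longleftrightarrow> 0 \<in> I \<and> (\<forall>x\<in>I. \<forall>y\<in>I. x + y \<in> I) \<and>
    (\<forall>r. \<forall>x\<in>I. r * x \<in> I \<and> x * r \<in> I)"

definition cbilinear :: "('a::complex_space \<Rightarrow> 'b::complex_space \<Rightarrow> 'c::complex_space) \<Rightarrow> bool"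
  where "cbilinear f \<longleftrightarrow> (\<forall>y. clinear (\<lambda>x. f x y)) \<and> (\<forall>x. clinear (f x))"

lemma clinearI:
  assumes "\<And>x y. f (x + y) = f x + f y" "\<And>c x. f (c *\<^sub>C x) = c *\<^sub>C f x"
  shows "clinear f"
  by unfold_locales (use assms in auto)

lemma clinear_add: "clinear f \<Longrightarrow> f (x + y) = f x + f y"
  by (simp add: linear_iff_module_hom module_hom_iff)

lemma clinear_scaleC: "clinear f \<Longrightarrow> f (c *\<^sub>C x) = c *\<^sub>C f x"
  by (simp add: linear_iff_module_hom module_hom_iff)

lemma clinear_0: "clinear f \<Longrightarrow> f 0 = 0"
  by (metis add_cancel_right_right clinear_add)

lemma clinear_diff: "clinear f \<Longrightarrow> f (x - y) = f x - f y"
  by (metis add_diff_cancel diff_add_cancel clinear_add)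

lemma cbilinearI:
  assumes "\<And>x x' y. f (x + x') y = f x y + f x' y" "\<And>c x y. f (c *\<^sub>C x) y = c *\<^sub>C f x y"
    "\<And>x y y'. f x (y + y') = f x y + f x y'" "\<And>c x y. f x (c *\<^sub>C y) = c *\<^sub>C f x y"
  shows "cbilinear f"
  unfolding cbilinear_def by (auto intro!: clinearI simp: assms)

lemma cbilinearD:
  assumes "cbilinear f"
  shows "f (x + x') y = f x y + f x' y" "f (c *\<^sub>C x) y = c *\<^sub>C f x y"
    "f x (y + y') = f x y + f x y'" "f x (c *\<^sub>C y) = c *\<^sub>C f x y"
  using assms unfolding cbilinear_def
  by (auto dest: clinear_add clinear_scaleC simp: linear_iff_module_hom module_hom_iff)

lemma scaleC_uminus: "- x = (- 1) *\<^sub>C (x::'a::complex_space)"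
  by simp

instantiation complex :: complex_algebra
begin
definition scaleC_complex :: "complex \<Rightarrow> complex \<Rightarrow> complex" where "scaleC_complex = (*)"
instance by standard (auto simp: scaleC_complex_def algebra_simps)
end

subsection \<open>Free vector spaces\<close>

instantiation poly_mapping :: (type, complex_space) complex_space
begin
lift_definition scaleC_poly_mapping :: "complex \<Rightarrow> ('a \<Rightarrow>\<^sub>0 'b) \<Rightarrow> 'a \<Rightarrow>\<^sub>0 'b"
  is "\<lambda>c f k. c *\<^sub>C f k"
proof -
  fix c :: complex and f :: "'a \<Rightarrow> 'b"
  assume "finite {k. f k \<noteq> 0}"
  then show "finite {k. c *\<^sub>C f k \<noteq> 0}"
    by (rule rev_finite_subset) auto
qed
instance
  by standard (transfer; simp add: fun_eq_iff scaleC_add_right scaleC_add_left)+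
end

lemma scaleC_single: "c *\<^sub>C Poly_Mapping.single k x = Poly_Mapping.single k (c *\<^sub>C x)"
  by transfer (auto simp: fun_eq_iff when_def)

lemma poly_mapping_additive_induct [case_names single add]:
  fixes p :: "'k \<Rightarrow>\<^sub>0 'v::complex_space"
  assumes single: "\<And>k c. P (Poly_Mapping.single k c)"
    and add: "\<And>p q. P p \<Longrightarrow> P q \<Longrightarrow> P (p + q)"
  shows "P p"
proof -
  have *: "P (\<Sum>k\<in>S. Poly_Mapping.single k (Poly_Mapping.lookup p k))" if "finite S" for S
    using that
  proof induction
    case empty
    show ?case using single[of undefined 0] by simp
  qed (simp add: single add)
  have "p = (\<Sum>k\<in>Poly_Mapping.keys p. Poly_Mapping.single k (Poly_Mapping.lookup p k))"
    by (rule poly_mapping_eqI)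
       (auto simp: lookup_sum lookup_single when_def in_keys_iff)
  with *[of "Poly_Mapping.keys p"] show ?thesis by simp
qed

instance poly_mapping :: (monoid_add, complex_algebra) complex_algebra
proof
  fix c :: complex and p q :: "'a \<Rightarrow>\<^sub>0 'b"
  show "(c *\<^sub>C p) * q = c *\<^sub>C (p * q)"
  proof (induction p rule: poly_mapping_additive_induct)
    case (single k a)
    show ?case
      by (induction q rule: poly_mapping_additive_induct)
         (simp_all add: scaleC_single mult_single mult_scaleC_left distrib_left scaleC_add_right)
  qed (simp add: scaleC_add_right distrib_right)
  show "p * (c *\<^sub>C q) = c *\<^sub>C (p * q)"
  proof (induction p rule: poly_mapping_additive_induct)
    case (single k a)
    show ?case
      by (induction q rule: poly_mapping_additive_induct)
         (simp_all add: scaleC_single mult_single mult_scaleC_right distrib_left scaleC_add_right)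
  qed (simp add: scaleC_add_right distrib_right)
qed

definition lin_ext :: "('k \<Rightarrow> 'v::complex_space) \<Rightarrow> ('k \<Rightarrow>\<^sub>0 complex) \<Rightarrow> 'v"
  where "lin_ext f p = (\<Sum>k\<in>Poly_Mapping.keys p. Poly_Mapping.lookup p k *\<^sub>C f k)"

lemma lin_ext_superset:
  assumes "finite S" "Poly_Mapping.keys p \<subseteq> S"
  shows "lin_ext f p = (\<Sum>k\<in>S. Poly_Mapping.lookup p k *\<^sub>C f k)"
  unfolding lin_ext_def
  by (rule sum.mono_neutral_left) (use assms in \<open>auto simp: in_keys_iff\<close>)

lemma lin_ext_linear: "clinear (lin_ext f)"
proof (rule clinearI)
  fix p q :: "'a \<Rightarrow>\<^sub>0 complex"
  let ?S = "Poly_Mapping.keys p \<union> Poly_Mapping.keys q"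
  have "lin_ext f (p + q) = (\<Sum>k\<in>?S. Poly_Mapping.lookup (p + q) k *\<^sub>C f k)"
    by (rule lin_ext_superset) (use Poly_Mapping.keys_add[of p q] in auto)
  also have "\<dots> = lin_ext f p + lin_ext f q"
    by (simp add: lookup_add scaleC_add_left sum.distrib lin_ext_superset[of ?S p] lin_ext_superset[of ?S q])
  finally show "lin_ext f (p + q) = lin_ext f p + lin_ext f q" .
next
  fix c :: complex and p :: "'a \<Rightarrow>\<^sub>0 complex"
  have "lin_ext f (c *\<^sub>C p) = (\<Sum>k\<in>Poly_Mapping.keys p. Poly_Mapping.lookup (c *\<^sub>C p) k *\<^sub>C f k)"
    by (rule lin_ext_superset) (auto simp: in_keys_iff scaleC_poly_mapping.rep_eq)
  then show "lin_ext f (c *\<^sub>C p) = c *\<^sub>C lin_ext f p"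
    by (simp add: lin_ext_def scaleC_poly_mapping.rep_eq scaleC_complex_def cvs.scale_sum_right)
qed

lemmas lin_ext_add = clinear_add[OF lin_ext_linear]
  and lin_ext_scaleC = clinear_scaleC[OF lin_ext_linear]
  and lin_ext_0 [simp] = clinear_0[OF lin_ext_linear]
  and lin_ext_diff = clinear_diff[OF lin_ext_linear]

lemma lin_ext_single: "lin_ext f (Poly_Mapping.single k c) = c *\<^sub>C f k"
  by (cases "c = 0") (simp_all add: lin_ext_def)

section \<open>Tensor products\<close>

definition tensor_rels :: "('a::complex_space \<times> 'b::complex_space \<Rightarrow>\<^sub>0 complex) set"
  where "tensor_rels =
    (let s = (\<lambda>x y. Poly_Mapping.single (x, y) 1) in
      {s (x + x') y - s x y - s x' y | x x' y. True} \<union>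
      {s x (y + y') - s x y - s x y' | x y y'. True} \<union>
      {s (c *\<^sub>C x) y - c *\<^sub>C s x y | c x y. True} \<union>
      {s x (c *\<^sub>C y) - c *\<^sub>C s x y | c x y. True})"

quotient_type (overloaded) ('a, 'b) ctensor =
    "('a::complex_space \<times> 'b::complex_space) \<Rightarrow>\<^sub>0 complex" / "\<lambda>p q. p - q \<in> cvs.span tensor_rels"
  morphisms rep_ctensor abs_ctensor
proof (rule equivpI)
  show "reflp (\<lambda>p q. p - q \<in> cvs.span tensor_rels)"
    by (rule reflpI) (simp add: cvs.span_zero)
  show "symp (\<lambda>p q. p - q \<in> cvs.span tensor_rels)"
    by (rule sympI) (metis cvs.span_neg minus_diff_eq)
  show "transp (\<lambda>p q. p - q \<in> cvs.span tensor_rels)"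
    by (rule transpI) (use cvs.span_add in fastforce)
qed

instantiation ctensor :: (complex_space, complex_space) complex_space
begin

lift_definition zero_ctensor :: "('a, 'b) ctensor" is 0 .

lift_definition plus_ctensor :: "('a, 'b) ctensor \<Rightarrow> ('a, 'b) ctensor \<Rightarrow> ('a, 'b) ctensor"
  is "(+)"
  by (simp add: add_diff_add cvs.span_add)

lift_definition minus_ctensor :: "('a, 'b) ctensor \<Rightarrow> ('a, 'b) ctensor \<Rightarrow> ('a, 'b) ctensor"
  is "(-)"
proof -
  fix p p' q q' :: "('a \<times> 'b) \<Rightarrow>\<^sub>0 complex"
  assume "p - p' \<in> cvs.span tensor_rels" "q - q' \<in> cvs.span tensor_rels"
  from cvs.span_diff[OF this] show "(p - q) - (p' - q') \<in> cvs.span tensor_rels"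
    by (simp add: algebra_simps)
qed

lift_definition uminus_ctensor :: "('a, 'b) ctensor \<Rightarrow> ('a, 'b) ctensor" is uminus
  by (subst minus_diff_minus) (rule cvs.span_neg)

lift_definition scaleC_ctensor :: "complex \<Rightarrow> ('a, 'b) ctensor \<Rightarrow> ('a, 'b) ctensor" is scaleC
  by (subst cvs.scale_right_diff_distrib[symmetric]) (rule cvs.span_scale)

instance
proof
  fix x y z :: "('a, 'b) ctensor" and c d :: complex
  show "x + y + z = x + (y + z)" "x + y = y + x" "0 + x = x" "- x + x = 0" "x - y = x + - y"
    "c *\<^sub>C (x + y) = c *\<^sub>C x + c *\<^sub>C y" "(c + d) *\<^sub>C x = c *\<^sub>C x + d *\<^sub>C x"
    "c *\<^sub>C (d *\<^sub>C x) = (c * d) *\<^sub>C x" "1 *\<^sub>C x = x"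
    by (transfer; simp add: scaleC_add_right scaleC_add_left ac_simps cvs.span_zero)+
qed

end

lift_definition tensor :: "'a::complex_space \<Rightarrow> 'b::complex_space \<Rightarrow> ('a, 'b) ctensor"
    (infixr \<open>\<otimes>\<^sub>t\<close> 72)
  is "\<lambda>x y. Poly_Mapping.single (x, y) 1" .

lemma cbilinear_tensor: "cbilinear (tensor :: 'a::complex_space \<Rightarrow> 'b::complex_space \<Rightarrow> _)"
proof (rule cbilinearI)
  show "(x + x') \<otimes>\<^sub>t y = x \<otimes>\<^sub>t y + x' \<otimes>\<^sub>t y" for x x' :: 'a and y :: 'b
    by transfer (rule cvs.span_base, unfold tensor_rels_def Let_def diff_diff_eq[symmetric], blast)
  show "(c *\<^sub>C x) \<otimes>\<^sub>t y = c *\<^sub>C (x \<otimes>\<^sub>t y)" for c and x :: 'a and y :: 'b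
    by transfer (rule cvs.span_base, unfold tensor_rels_def Let_def, blast)
  show "x \<otimes>\<^sub>t (y + y') = x \<otimes>\<^sub>t y + x \<otimes>\<^sub>t y'" for x :: 'a and y y' :: 'b
    by transfer (rule cvs.span_base, unfold tensor_rels_def Let_def diff_diff_eq[symmetric], blast)
  show "x \<otimes>\<^sub>t (c *\<^sub>C y) = c *\<^sub>C (x \<otimes>\<^sub>t y)" for c and x :: 'a and y :: 'b
    by transfer (rule cvs.span_base, unfold tensor_rels_def Let_def, blast)
qed

lemmas tensor_add_left = cbilinearD(1)[OF cbilinear_tensor]
  and tensor_scaleC_left = cbilinearD(2)[OF cbilinear_tensor]
  and tensor_add_right = cbilinearD(3)[OF cbilinear_tensor]
  and tensor_scaleC_right = cbilinearD(4)[OF cbilinear_tensor]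

lemma ctensor_induct [case_names tensor add]:
  fixes t :: "('a::complex_space, 'b::complex_space) ctensor"
  assumes tensor: "\<And>a b. P (a \<otimes>\<^sub>t b)" and add: "\<And>s t. P s \<Longrightarrow> P t \<Longrightarrow> P (s + t)"
  shows "P t"
proof (induction t rule: ctensor.abs_induct)
  fix p :: "('a \<times> 'b) \<Rightarrow>\<^sub>0 complex"
  show "P (abs_ctensor p)"
  proof (induction p rule: poly_mapping_additive_induct)
    case (single k c)
    have "abs_ctensor (Poly_Mapping.single k c) = c *\<^sub>C (fst k \<otimes>\<^sub>t snd k)"
      by (simp add: tensor.abs_eq scaleC_ctensor.abs_eq scaleC_single scaleC_complex_def)
    then show ?case by (simp add: tensor flip: tensor_scaleC_left)
  qed (simp add: add flip: plus_ctensor.abs_eq)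
qed

text \<open>The linear map on the tensor product induced by a bilinear map (meaningful only for those).\<close>

definition tensor_lift :: "('a::complex_space \<Rightarrow> 'b::complex_space \<Rightarrow> 'c::complex_space)
    \<Rightarrow> ('a, 'b) ctensor \<Rightarrow> 'c"
  where "tensor_lift f t = lin_ext (\<lambda>(x, y). f x y) (rep_ctensor t)"

lemma tensor_lift_abs:
  assumes "cbilinear f"
  shows "tensor_lift f (abs_ctensor p) = lin_ext (\<lambda>(x, y). f x y) p"
proof -
  let ?F = "lin_ext (\<lambda>(x, y). f x y)"
  have "?F r = 0" if "r \<in> cvs.span tensor_rels" for r
    using that
  proof (induction rule: cvs.span_induct_alt)
    case (step c x y)
    from step(1) have "?F x = 0"
      by (auto simp: tensor_rels_def lin_ext_diff lin_ext_scaleC lin_ext_single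
          cbilinearD[OF assms])
    then show ?case using step by (simp add: lin_ext_add lin_ext_scaleC)
  qed simp
  moreover have "rep_ctensor (abs_ctensor p) - p \<in> cvs.span tensor_rels"
    using Quotient3_rep_abs[OF Quotient3_ctensor, of p] by (simp add: cvs.span_zero)
  ultimately show ?thesis
    by (metis tensor_lift_def lin_ext_diff eq_iff_diff_eq_0)
qed

lemma tensor_lift_tensor: "cbilinear f \<Longrightarrow> tensor_lift f (x \<otimes>\<^sub>t y) = f x y"
  by (simp add: tensor.abs_eq tensor_lift_abs lin_ext_single scaleC_one)

lemma tensor_lift_linear: "cbilinear f \<Longrightarrow> clinear (tensor_lift f)"
proof (rule clinearI)
  assume f: "cbilinear f"
  show "tensor_lift f (s + t) = tensor_lift f s + tensor_lift f t" for s t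
    by (induction s rule: ctensor.abs_induct, induction t rule: ctensor.abs_induct)
       (simp add: plus_ctensor.abs_eq tensor_lift_abs[OF f] lin_ext_add)
  show "tensor_lift f (c *\<^sub>C t) = c *\<^sub>C tensor_lift f t" for c t
    by (induction t rule: ctensor.abs_induct)
       (simp add: scaleC_ctensor.abs_eq tensor_lift_abs[OF f] lin_ext_scaleC)
qed

lemmas tensor_lift_add = clinear_add[OF tensor_lift_linear]
  and tensor_lift_scaleC = clinear_scaleC[OF tensor_lift_linear]

lemma tensor_lift_fun_add:
  "tensor_lift (\<lambda>x y. f x y + g x y) t = tensor_lift f t + tensor_lift g t"
  by (simp add: tensor_lift_def lin_ext_def scaleC_add_right sum.distrib case_prod_unfold)

lemma tensor_lift_fun_scaleC: "tensor_lift (\<lambda>x y. c *\<^sub>C f x y) t = c *\<^sub>C tensor_lift f t"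
  by (simp add: tensor_lift_def lin_ext_def cvs.scale_sum_right case_prod_unfold mult.commute)

lemma tensor_nonzero:
  fixes a :: "'a::complex_space" and b :: "'b::complex_space"
  assumes "a \<noteq> 0" "b \<noteq> 0"
  shows "a \<otimes>\<^sub>t b \<noteq> 0"
proof -
  interpret A: vector_space_pair "scaleC :: complex \<Rightarrow> 'a \<Rightarrow> 'a" "scaleC :: complex \<Rightarrow> complex \<Rightarrow> complex" ..
  interpret B: vector_space_pair "scaleC :: complex \<Rightarrow> 'b \<Rightarrow> 'b" "scaleC :: complex \<Rightarrow> complex \<Rightarrow> complex" ..
  have ia: "cvs.independent {a}" and ib: "cvs.independent {b}" using assms by simp_all
  obtain f where f: "clinear f" "f a = (1::complex)"
    using A.linear_independent_extend[OF ia, of "\<lambda>_. 1"] by auto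
  obtain g where g: "clinear g" "g b = (1::complex)"
    using B.linear_independent_extend[OF ib, of "\<lambda>_. 1"] by auto
  have bil: "cbilinear (\<lambda>x y. f x * g y)"
    using f(1) g(1)
    by (intro cbilinearI)
       (simp_all add: clinear_add clinear_scaleC distrib_left distrib_right mult_scaleC_left mult_scaleC_right)
  have "tensor_lift (\<lambda>x y. f x * g y) (a \<otimes>\<^sub>t b) = 1"
    by (simp add: tensor_lift_tensor[OF bil] f g)
  then show ?thesis
    using clinear_0[OF tensor_lift_linear[OF bil]] by auto
qed

instantiation ctensor :: (complex_algebra, complex_algebra) complex_algebra
begin

definition one_ctensor :: "('a, 'b) ctensor" where "one_ctensor = 1 \<otimes>\<^sub>t 1"

definition times_ctensor :: "('a, 'b) ctensor \<Rightarrow> ('a, 'b) ctensor \<Rightarrow> ('a, 'b) ctensor"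
  where "s * t = tensor_lift (\<lambda>a b. tensor_lift (\<lambda>a' b'. (a * a') \<otimes>\<^sub>t (b * b')) t) s"

lemma cbilinear_ctensor_mult_aux:
  "cbilinear (\<lambda>a' b'. (a * a') \<otimes>\<^sub>t (b * b'))" for a :: 'a and b :: 'b
  by (rule cbilinearI)
     (simp_all add: distrib_left mult_scaleC_right tensor_add_left tensor_add_right
        tensor_scaleC_left tensor_scaleC_right)

lemma cbilinear_ctensor_mult_aux2:
  "cbilinear (\<lambda>a b. tensor_lift (\<lambda>a' b'. (a * a') \<otimes>\<^sub>t (b * b')) t)"
  for t :: "('a, 'b) ctensor"
  by (rule cbilinearI)
     (simp_all add: distrib_right mult_scaleC_left tensor_add_left tensor_add_right
        tensor_scaleC_left tensor_scaleC_right tensor_lift_fun_add tensor_lift_fun_scaleC)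

lemma tensor_mult: "(a \<otimes>\<^sub>t b) * (a' \<otimes>\<^sub>t b') = (a * a') \<otimes>\<^sub>t (b * b')"
  for a a' :: 'a and b b' :: 'b
  unfolding times_ctensor_def tensor_lift_tensor[OF cbilinear_ctensor_mult_aux2]
  by (rule tensor_lift_tensor[OF cbilinear_ctensor_mult_aux])

lemma cbilinear_ctensor_times:
  "cbilinear ((*) :: ('a, 'b) ctensor \<Rightarrow> ('a, 'b) ctensor \<Rightarrow> ('a, 'b) ctensor)"
proof (rule cbilinearI)
  fix s s' t t' :: "('a, 'b) ctensor" and c :: complex
  show "(s + s') * t = s * t + s' * t"
    by (simp add: times_ctensor_def tensor_lift_add cbilinear_ctensor_mult_aux2)
  show "(c *\<^sub>C s) * t = c *\<^sub>C (s * t)"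
    by (simp add: times_ctensor_def tensor_lift_scaleC cbilinear_ctensor_mult_aux2)
  show "s * (t + t') = s * t + s * t'"
    by (simp add: times_ctensor_def tensor_lift_add cbilinear_ctensor_mult_aux tensor_lift_fun_add)
  show "s * (c *\<^sub>C t) = c *\<^sub>C (s * t)"
    by (simp add: times_ctensor_def tensor_lift_scaleC cbilinear_ctensor_mult_aux tensor_lift_fun_scaleC)
qed

instance
proof
  note bil = cbilinearD[OF cbilinear_ctensor_times]
  fix s t u :: "('a, 'b) ctensor" and c :: complex
  show "(s + t) * u = s * u + t * u" "s * (t + u) = s * t + s * u"
    "(c *\<^sub>C s) * t = c *\<^sub>C (s * t)" "s * (c *\<^sub>C t) = c *\<^sub>C (s * t)"
    by (fact bil)+
  show "1 * s = s" "s * 1 = s"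
    by (induction s rule: ctensor_induct; simp add: one_ctensor_def tensor_mult bil)+
  show "(0::('a, 'b) ctensor) \<noteq> 1"
    using tensor_nonzero[of "1::'a" "1::'b"] by (simp add: one_ctensor_def)
  show "s * t * u = s * (t * u)"
  proof (induction s rule: ctensor_induct)
    case (tensor a b)
    show ?case
    proof (induction t rule: ctensor_induct)
      case (tensor a' b')
      show ?case
        by (induction u rule: ctensor_induct) (simp_all add: tensor_mult mult.assoc bil)
    qed (simp add: bil)
  qed (simp add: bil)
qed

end

section \<open>Universal enveloping algebras\<close>

datatype 'x word = Word (letters: "'x list")

instantiation word :: (type) monoid_add
begin
definition "0 = Word []"
definition "v + w = Word (letters v @ letters w)"
instance by standard (auto simp: zero_word_def plus_word_def)
end

text \<open>
  \<open>'g word \<Rightarrow>\<^sub>0 complex\<close> is the free associative algebra on the underlying set of \<open>'g\<close>. Dividing by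
  the first two families of relations yields the tensor algebra of \<open>'g\<close>; the third one then
  yields the enveloping algebra.
\<close>

definition uea_rels :: "('g::lie_algebra word \<Rightarrow>\<^sub>0 complex) set"
  where "uea_rels =
    (let g = (\<lambda>x. Poly_Mapping.single (Word [x]) 1) in
      {g (x + y) - g x - g y | x y. True} \<union>
      {g (c *\<^sub>C x) - c *\<^sub>C g x | c x. True} \<union>
      {g x * g y - g y * g x - g (lie x y) | x y. True})"

lemma two_sided_ideal_hull: "two_sided_ideal (two_sided_ideal hull S)"
  by (rule hull_in) (unfold two_sided_ideal_def, blast)

lemma two_sided_ideal_uminus: "two_sided_ideal I \<Longrightarrow> x \<in> I \<Longrightarrow> - x \<in> I"
  unfolding two_sided_ideal_def by (metis mult_minus1)

lemma two_sided_ideal_diff: "two_sided_ideal I \<Longrightarrow> x \<in> I \<Longrightarrow> y \<in> I \<Longrightarrow> x - y \<in> I"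
  using two_sided_ideal_uminus[of I y] unfolding two_sided_ideal_def
  by (metis diff_conv_add_uminus)

lemma two_sided_ideal_scaleC:
  fixes x :: "'a::complex_algebra"
  shows "two_sided_ideal I \<Longrightarrow> x \<in> I \<Longrightarrow> c *\<^sub>C x \<in> I"
  unfolding two_sided_ideal_def by (metis mult_scaleC_left mult_1)

quotient_type (overloaded) 'g uea =
    "'g::lie_algebra word \<Rightarrow>\<^sub>0 complex" / "\<lambda>p q. p - q \<in> two_sided_ideal hull uea_rels"
  morphisms rep_uea abs_uea
proof (rule equivpI)
  note I = two_sided_ideal_hull[of "uea_rels :: ('g word \<Rightarrow>\<^sub>0 complex) set"]
  show "reflp (\<lambda>p q. p - q \<in> two_sided_ideal hull (uea_rels :: ('g word \<Rightarrow>\<^sub>0 complex) set))"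
    using I by (auto intro!: reflpI simp: two_sided_ideal_def)
  show "symp (\<lambda>p q. p - q \<in> two_sided_ideal hull (uea_rels :: ('g word \<Rightarrow>\<^sub>0 complex) set))"
    by (rule sympI) (metis two_sided_ideal_uminus[OF I] minus_diff_eq)
  show "transp (\<lambda>p q. p - q \<in> two_sided_ideal hull (uea_rels :: ('g word \<Rightarrow>\<^sub>0 complex) set))"
    using I unfolding two_sided_ideal_def by (intro transpI) fastforce
qed

lemma foldr_clinear:
  assumes "\<And>x. clinear (act x)"
  shows "clinear (foldr act xs)"
proof (induction xs)
  case Nil
  show ?case by (auto intro: clinearI)
next
  case (Cons x xs)
  then show ?case using assms[of x]
    by (auto intro!: clinearI simp: clinear_add clinear_scaleC)
qed

definition free_act :: "('g \<Rightarrow> 'v \<Rightarrow> 'v::complex_space) \<Rightarrow> ('g word \<Rightarrow>\<^sub>0 complex) \<Rightarrow> 'v \<Rightarrow> 'v"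
  where "free_act act p v = lin_ext (\<lambda>w. foldr act (letters w) v) p"

lemma free_act_simps:
  "free_act act (p + q) v = free_act act p v + free_act act q v"
  "free_act act (p - q) v = free_act act p v - free_act act q v"
  "free_act act (c *\<^sub>C p) v = c *\<^sub>C free_act act p v"
  "free_act act 0 v = 0"
  "free_act act (Poly_Mapping.single w c) v = c *\<^sub>C foldr act (letters w) v"
  by (simp_all add: free_act_def lin_ext_add lin_ext_diff lin_ext_scaleC lin_ext_single)

lemma free_act_linear:
  assumes "\<And>x. clinear (act x)"
  shows "clinear (free_act act p)"
proof (rule clinearI)
  show "free_act act p (v + w) = free_act act p v + free_act act p w" for v w
    by (induction p rule: poly_mapping_additive_induct)
       (simp_all add: free_act_simps clinear_add[OF foldr_clinear[OF assms]] scaleC_add_right)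
  show "free_act act p (c *\<^sub>C v) = c *\<^sub>C free_act act p v" for c v
    by (induction p rule: poly_mapping_additive_induct)
       (simp_all add: free_act_simps clinear_scaleC[OF foldr_clinear[OF assms]] scaleC_add_right mult.commute)
qed

lemma free_act_mult:
  assumes "\<And>x. clinear (act x)"
  shows "free_act act (p * q) v = free_act act p (free_act act q v)"
proof (induction p rule: poly_mapping_additive_induct)
  case (single w c)
  show ?case
  proof (induction q rule: poly_mapping_additive_induct)
    case (single w' c')
    show ?case
      by (simp add: mult_single free_act_simps plus_word_def
          clinear_scaleC[OF foldr_clinear[OF assms]])
  qed (simp add: distrib_left free_act_simps clinear_add[OF free_act_linear[OF assms]]
         clinear_add[OF foldr_clinear[OF assms]] scaleC_add_right)
qed (simp add: distrib_right free_act_simps)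

definition lie_rep :: "('g::lie_algebra \<Rightarrow> 'v \<Rightarrow> 'v::complex_space) \<Rightarrow> bool"
  where "lie_rep act \<longleftrightarrow> cbilinear act \<and>
    (\<forall>x y v. act (lie x y) v = act x (act y v) - act y (act x v))"

lemma free_act_uea_rels:
  assumes act: "lie_rep act" and "p \<in> two_sided_ideal hull uea_rels"
  shows "free_act act p v = 0"
proof -
  have lin: "\<And>x. clinear (act x)" and bil: "cbilinear act"
    using act by (auto simp: lie_rep_def cbilinear_def)
  let ?K = "{p. \<forall>v. free_act act p v = 0}"
  have "two_sided_ideal ?K"
    by (auto simp: two_sided_ideal_def free_act_simps free_act_mult[OF lin]
        clinear_0[OF free_act_linear[OF lin]])
  moreover have "uea_rels \<subseteq> ?K"
    using act
    by (auto simp: uea_rels_def Let_def free_act_simps free_act_mult[OF lin] cbilinearD[OF bil]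
        lie_rep_def)
  ultimately have "two_sided_ideal hull uea_rels \<subseteq> ?K"
    by (intro hull_minimal)
  then show ?thesis using assms(2) by auto
qed

instantiation uea :: (lie_algebra) complex_algebra
begin

lift_definition zero_uea :: "'a uea" is 0 .

lift_definition one_uea :: "'a uea" is 1 .

lift_definition plus_uea :: "'a uea \<Rightarrow> 'a uea \<Rightarrow> 'a uea" is "(+)"
  using two_sided_ideal_hull[of "uea_rels :: ('a word \<Rightarrow>\<^sub>0 complex) set"]
  by (simp add: add_diff_add two_sided_ideal_def)

lift_definition minus_uea :: "'a uea \<Rightarrow> 'a uea \<Rightarrow> 'a uea" is "(-)"
proof -
  fix p p' q q' :: "'a word \<Rightarrow>\<^sub>0 complex"
  assume "p - p' \<in> two_sided_ideal hull uea_rels" "q - q' \<in> two_sided_ideal hull uea_rels"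
  from two_sided_ideal_diff[OF two_sided_ideal_hull this]
  show "(p - q) - (p' - q') \<in> two_sided_ideal hull uea_rels"
    by (simp add: algebra_simps)
qed

lift_definition uminus_uea :: "'a uea \<Rightarrow> 'a uea" is uminus
  by (subst minus_diff_minus) (rule two_sided_ideal_uminus[OF two_sided_ideal_hull])

lift_definition scaleC_uea :: "complex \<Rightarrow> 'a uea \<Rightarrow> 'a uea" is scaleC
  by (subst cvs.scale_right_diff_distrib[symmetric]) (rule two_sided_ideal_scaleC[OF two_sided_ideal_hull])

lift_definition times_uea :: "'a uea \<Rightarrow> 'a uea \<Rightarrow> 'a uea" is "(*)"
proof -
  fix p p' q q' :: "'a word \<Rightarrow>\<^sub>0 complex"
  assume *: "p - p' \<in> two_sided_ideal hull uea_rels" "q - q' \<in> two_sided_ideal hull uea_rels"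
  have "(p - p') * q + p' * (q - q') \<in> two_sided_ideal hull uea_rels"
    using two_sided_ideal_hull[of "uea_rels :: ('a word \<Rightarrow>\<^sub>0 complex) set"] *
    by (simp add: two_sided_ideal_def)
  then show "p * q - p' * q' \<in> two_sided_ideal hull uea_rels"
    by (simp add: algebra_simps)
qed

instance
proof
  have z: "0 \<in> two_sided_ideal hull (uea_rels :: ('a word \<Rightarrow>\<^sub>0 complex) set)"
    using two_sided_ideal_hull unfolding two_sided_ideal_def by blast
  fix x y w :: "'a uea" and c d :: complex
  show "x + y + w = x + (y + w)" "x + y = y + x" "0 + x = x" "- x + x = 0" "x - y = x + - y"
    "(x + y) * w = x * w + y * w" "x * (y + w) = x * y + x * w" "1 * x = x" "x * 1 = x"
    "x * y * w = x * (y * w)"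
    by (transfer; simp add: algebra_simps z)+
  show "c *\<^sub>C (x + y) = c *\<^sub>C x + c *\<^sub>C y" "(c + d) *\<^sub>C x = c *\<^sub>C x + d *\<^sub>C x"
    "c *\<^sub>C (d *\<^sub>C x) = (c * d) *\<^sub>C x" "1 *\<^sub>C x = x"
    "(c *\<^sub>C x) * y = c *\<^sub>C (x * y)" "x * (c *\<^sub>C y) = c *\<^sub>C (x * y)"
    by (transfer; simp add: z scaleC_add_right scaleC_add_left mult_scaleC_left mult_scaleC_right)+
  show "(0::'a uea) \<noteq> 1"
  proof transfer
    have rep: "lie_rep (\<lambda>(_::'a) (_::complex). 0)"
      by (auto simp: lie_rep_def intro!: cbilinearI)
    have "free_act (\<lambda>(_::'a) (_::complex). 0) 1 1 = 1"
      by (simp add: free_act_simps zero_word_def flip: single_one)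
    then have "free_act (\<lambda>(_::'a) (_::complex). 0) (0 - 1) 1 = - 1"
      unfolding free_act_simps(2) by (simp add: free_act_simps(4))
    then show "0 - 1 \<notin> two_sided_ideal hull (uea_rels :: ('a word \<Rightarrow>\<^sub>0 complex) set)"
      using free_act_uea_rels[OF rep, of "0 - 1" 1] by auto
  qed
qed

end

lift_definition uea_of :: "'g::lie_algebra \<Rightarrow> 'g uea"
  is "\<lambda>x. Poly_Mapping.single (Word [x]) 1" .

lemma uea_of_simps:
  fixes x y :: "'g::lie_algebra"
  shows "uea_of (x + y) = uea_of x + uea_of y"
    and "uea_of (c *\<^sub>C x) = c *\<^sub>C uea_of x"
    and "uea_of (lie x y) = uea_of x * uea_of y - uea_of y * uea_of x"
proof -
  have I: "p - q \<in> two_sided_ideal hull uea_rels" if "q - p \<in> uea_rels \<or> p - q \<in> uea_rels"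
    for p q :: "'g word \<Rightarrow>\<^sub>0 complex"
    using that two_sided_ideal_uminus[OF two_sided_ideal_hull, of "q - p" uea_rels]
      hull_subset[of "uea_rels :: ('g word \<Rightarrow>\<^sub>0 complex) set" two_sided_ideal] by auto
  show "uea_of (x + y) = uea_of x + uea_of y"
    by transfer (rule I, unfold uea_rels_def Let_def diff_diff_eq[symmetric], blast)
  show "uea_of (c *\<^sub>C x) = c *\<^sub>C uea_of x"
    by transfer (rule I, unfold uea_rels_def Let_def, blast)
  show "uea_of (lie x y) = uea_of x * uea_of y - uea_of y * uea_of x"
    by transfer (rule I, unfold uea_rels_def Let_def, blast)
qed

lemma uea_induct [case_names one mult add scale]:
  fixes u :: "'g::lie_algebra uea"
  assumes one: "P 1" and mult: "\<And>x u. P u \<Longrightarrow> P (uea_of x * u)"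
    and add: "\<And>u v. P u \<Longrightarrow> P v \<Longrightarrow> P (u + v)" and scale: "\<And>c u. P u \<Longrightarrow> P (c *\<^sub>C u)"
  shows "P u"
proof (induction u rule: uea.abs_induct)
  fix p :: "'g word \<Rightarrow>\<^sub>0 complex"
  have word: "P (abs_uea (Poly_Mapping.single (Word xs) 1))" for xs
  proof (induction xs)
    case Nil
    then show ?case using one by (simp add: one_uea.abs_eq flip: single_one zero_word_def)
  next
    case (Cons x xs)
    have "abs_uea (Poly_Mapping.single (Word (x # xs)) 1)
        = uea_of x * abs_uea (Poly_Mapping.single (Word xs) 1)"
      by (simp add: uea_of.abs_eq times_uea.abs_eq mult_single plus_word_def)
    then show ?case using mult[OF Cons] by simp
  qed
  show "P (abs_uea p)"
  proof (induction p rule: poly_mapping_additive_induct)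
    case (single w c)
    have "abs_uea (Poly_Mapping.single w c) = c *\<^sub>C abs_uea (Poly_Mapping.single (Word (letters w)) 1)"
      by (simp add: scaleC_uea.abs_eq scaleC_single scaleC_complex_def)
    then show ?case using scale[OF word[of "letters w"], of c] by (simp only:)
  qed (simp add: add flip: plus_uea.abs_eq)
qed

text \<open>The action of the enveloping algebra induced by a representation of the Lie algebra.\<close>

definition uea_act :: "('g::lie_algebra \<Rightarrow> 'v \<Rightarrow> 'v::complex_space) \<Rightarrow> 'g uea \<Rightarrow> 'v \<Rightarrow> 'v"
  where "uea_act act u v = free_act act (rep_uea u) v"

lemma uea_act_abs:
  assumes "lie_rep act"
  shows "uea_act act (abs_uea p :: 'g::lie_algebra uea) v = free_act act p v"
proof -
  have "rep_uea (abs_uea p) - p \<in> two_sided_ideal hull uea_rels"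
    using Quotient3_rep_abs[OF Quotient3_uea, of p] two_sided_ideal_hull[of "uea_rels :: ('g word \<Rightarrow>\<^sub>0 complex) set"]
    by (simp add: two_sided_ideal_def)
  from free_act_uea_rels[OF assms this, of v] show ?thesis
    by (simp add: uea_act_def free_act_simps)
qed

lemma uea_act_simps:
  assumes "lie_rep act"
  shows "uea_act act (u + u') v = uea_act act u v + uea_act act u' v"
    and "uea_act act (c *\<^sub>C u) v = c *\<^sub>C uea_act act u v"
    and "uea_act act u (v + v') = uea_act act u v + uea_act act u v'"
    and "uea_act act u (c *\<^sub>C v) = c *\<^sub>C uea_act act u v"
    and "uea_act act 1 v = v"
    and "uea_act act (uea_of x) v = act x v"
    and "uea_act act (u * u') v = uea_act act u (uea_act act u' v)"
proof -
  have lin: "\<And>x. clinear (act x)"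
    using assms by (auto simp: lie_rep_def cbilinear_def)
  note abs = uea_act_abs[OF assms]
  show "uea_act act (u + u') v = uea_act act u v + uea_act act u' v"
    by (induction u rule: uea.abs_induct, induction u' rule: uea.abs_induct)
       (simp add: abs plus_uea.abs_eq free_act_simps)
  show "uea_act act (c *\<^sub>C u) v = c *\<^sub>C uea_act act u v"
    by (induction u rule: uea.abs_induct) (simp add: abs scaleC_uea.abs_eq free_act_simps)
  show "uea_act act u (v + v') = uea_act act u v + uea_act act u v'"
    "uea_act act u (c *\<^sub>C v) = c *\<^sub>C uea_act act u v"
    by (simp_all add: uea_act_def clinear_add[OF free_act_linear[OF lin]]
        clinear_scaleC[OF free_act_linear[OF lin]])
  show "uea_act act 1 v = v"
    by (simp add: one_uea.abs_eq abs free_act_simps zero_word_def scaleC_one flip: single_one)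
  show "uea_act act (uea_of x) v = act x v"
    by (simp add: uea_of.abs_eq abs free_act_simps scaleC_one)
  show "uea_act act (u * u') v = uea_act act u (uea_act act u' v)"
    by (induction u rule: uea.abs_induct, induction u' rule: uea.abs_induct)
       (simp add: abs times_uea.abs_eq free_act_mult[OF lin])
qed


section \<open>The algebra \<open>A\<^sub>n\<close> and the Lie algebra \<open>\<gg>\<^sub>n\<close>\<close>

text \<open>
  The index set \<open>{1, \<dots>, n}\<close> is a finite (and nonempty) type \<open>'n\<close>. The key \<open>(a, m)\<close> stands for the
  monomial \<open>t\<^sup>a x\<^sup>m\<close>; multiplication is that of the monoid algebra.
\<close>

type_synonym 'n An = "(('n \<Rightarrow> int) \<times> ('n \<Rightarrow> nat)) \<Rightarrow>\<^sub>0 complex"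

definition tx :: "('n \<Rightarrow> int) \<Rightarrow> ('n \<Rightarrow> nat) \<Rightarrow> 'n An"
  where "tx a m = Poly_Mapping.single (a, m) 1"

definition tvar :: "'n \<Rightarrow> 'n An"
  where "tvar i = tx (\<lambda>j. if j = i then 1 else 0) 0"

definition xvar :: "'n \<Rightarrow> 'n An"
  where "xvar i = tx 0 (\<lambda>j. if j = i then 1 else 0)"

text \<open>The operators \<open>t\<^sub>i \<partial>/\<partial>t\<^sub>i\<close>, \<open>\<partial>/\<partial>x\<^sub>i\<close> and \<open>d\<^sub>i\<close>; in the second, the truncated exponent is harmless.\<close>

definition t_dt :: "'n \<Rightarrow> 'n An \<Rightarrow> 'n An"
  where "t_dt i = lin_ext (\<lambda>(a, m). of_int (a i) *\<^sub>C tx a m)"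

definition dx :: "'n \<Rightarrow> 'n An \<Rightarrow> 'n An"
  where "dx i = lin_ext (\<lambda>(a, m). of_nat (m i) *\<^sub>C tx a (m(i := m i - 1)))"

definition dd :: "'n \<Rightarrow> 'n An \<Rightarrow> 'n An"
  where "dd i p = t_dt i p + dx i p"

lemma tx_mult: "tx a m * tx b k = tx (a + b) (m + k)"
  by (simp add: tx_def mult_single)

lemma tx_0: "tx 0 0 = 1"
  by (simp add: tx_def flip: zero_prod_def)

lemma An_induct [case_names tx add scale]:
  fixes p :: "'n An"
  assumes "\<And>a m. P (tx a m)" "\<And>p q. P p \<Longrightarrow> P q \<Longrightarrow> P (p + q)" "\<And>c p. P p \<Longrightarrow> P (c *\<^sub>C p)"
  shows "P p"
proof (induction p rule: poly_mapping_additive_induct)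
  case (single k c)
  have "Poly_Mapping.single k c = c *\<^sub>C tx (fst k) (snd k)"
    by (simp add: tx_def scaleC_single scaleC_complex_def)
  then show ?case using assms(1,3) by metis
qed (rule assms)

lemma dd_linear: "clinear (dd i)"
  by (rule clinearI) (simp_all add: dd_def t_dt_def dx_def lin_ext_add lin_ext_scaleC scaleC_add_right)

lemmas dd_add = clinear_add[OF dd_linear]
  and dd_scaleC = clinear_scaleC[OF dd_linear]
  and dd_0 [simp] = clinear_0[OF dd_linear]
  and dd_diff = clinear_diff[OF dd_linear]

lemma dd_sum: "dd i (sum f S) = (\<Sum>j\<in>S. dd i (f j))"
  by (induction S rule: infinite_finite_induct) (simp_all add: dd_add)

lemma dd_tx:
  "dd i (tx a m) = of_int (a i) *\<^sub>C tx a m + of_nat (m i) *\<^sub>C tx a (m(i := m i - 1))"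
  by (simp add: dd_def t_dt_def dx_def tx_def[of a m] lin_ext_single)

lemma dd_mult: "dd i (p * q) = p * dd i q + q * dd i p"
proof (induction p rule: An_induct)
  case (tx a m)
  show ?case
  proof (induction q rule: An_induct)
    case (tx b k)
    have shift: "m i = 0 \<or> (m + k)(i := m i + k i - 1) = m(i := m i - 1) + k"
      for m k :: "'a \<Rightarrow> nat"
      by (auto simp: fun_eq_iff)
    show ?case
      using shift[of m k] shift[of k m]
      by (auto simp: dd_tx tx_mult distrib_left mult_scaleC_left mult_scaleC_right scaleC_add_left
          ac_simps)
  qed (simp_all add: distrib_left distrib_right dd_add dd_scaleC mult_scaleC_left mult_scaleC_right
      scaleC_add_right)
qed (simp_all add: distrib_left distrib_right dd_add dd_scaleC mult_scaleC_left mult_scaleC_right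
      scaleC_add_right)

lemma dd_commute: "dd i (dd j p) = dd j (dd i p)"
proof (induction p rule: An_induct)
  case (tx a m)
  show ?case
    by (cases "i = j")
       (simp_all add: dd_tx dd_add dd_scaleC scaleC_add_right fun_upd_twist[of i j] algebra_simps)
qed (simp_all add: dd_add dd_scaleC)

text \<open>An element \<open>\<Sum>\<^sub>i f\<^sub>i d\<^sub>i\<close> of \<open>\<gg>\<^sub>n\<close> is given by its coefficients \<open>f\<^sub>i\<close>.\<close>

typedef 'n gn = "UNIV :: ('n::finite \<Rightarrow> 'n An) set"
  morphisms coeff Gn ..

definition vf :: "'n::finite An \<Rightarrow> 'n \<Rightarrow> 'n gn"
  where "vf f i = Gn (\<lambda>j. if j = i then f else 0)"

lemma coeff_vf: "coeff (vf f i) j = (if j = i then f else 0)"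
  by (simp add: vf_def Gn_inverse)

definition vf_apply :: "'n::finite gn \<Rightarrow> 'n An \<Rightarrow> 'n An"
  where "vf_apply X p = (\<Sum>i\<in>UNIV. coeff X i * dd i p)"

lemma vf_apply_linear: "clinear (vf_apply X)"
  by (rule clinearI)
     (simp_all add: vf_apply_def dd_add dd_scaleC distrib_left sum.distrib mult_scaleC_right
        cvs.scale_sum_right)

lemmas vf_apply_add = clinear_add[OF vf_apply_linear]
  and vf_apply_scaleC = clinear_scaleC[OF vf_apply_linear]
  and vf_apply_diff = clinear_diff[OF vf_apply_linear]

lemma vf_apply_mult: "vf_apply X (p * q) = p * vf_apply X q + q * vf_apply X p"
  by (simp add: vf_apply_def dd_mult sum_distrib_left distrib_left sum.distrib mult.left_commute)

instantiation gn :: (finite) lie_algebra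
begin

definition zero_gn :: "'a gn" where "0 = Gn (\<lambda>i. 0)"
definition plus_gn :: "'a gn \<Rightarrow> 'a gn \<Rightarrow> 'a gn" where "X + Y = Gn (\<lambda>i. coeff X i + coeff Y i)"
definition minus_gn :: "'a gn \<Rightarrow> 'a gn \<Rightarrow> 'a gn" where "X - Y = Gn (\<lambda>i. coeff X i - coeff Y i)"
definition uminus_gn :: "'a gn \<Rightarrow> 'a gn" where "- X = Gn (\<lambda>i. - coeff X i)"
definition scaleC_gn :: "complex \<Rightarrow> 'a gn \<Rightarrow> 'a gn" where "c *\<^sub>C X = Gn (\<lambda>i. c *\<^sub>C coeff X i)"

definition lie_gn :: "'a gn \<Rightarrow> 'a gn \<Rightarrow> 'a gn"
  where "lie X Y = Gn (\<lambda>j. vf_apply X (coeff Y j) - vf_apply Y (coeff X j))"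

lemma coeff_simps:
  "coeff (X + Y) i = coeff X i + coeff Y i" "coeff (X - Y) i = coeff X i - coeff Y i"
  "coeff (- X) i = - coeff X i" "coeff (c *\<^sub>C X) i = c *\<^sub>C coeff X i" "coeff 0 i = 0"
  "coeff (lie X Y) i = vf_apply X (coeff Y i) - vf_apply Y (coeff X i)" for X Y :: "'a gn"
  by (simp_all add: plus_gn_def minus_gn_def uminus_gn_def scaleC_gn_def zero_gn_def lie_gn_def
      Gn_inverse)

lemma vf_apply_simps:
  "vf_apply (X + Y) p = vf_apply X p + vf_apply Y p"
  "vf_apply (c *\<^sub>C X) p = c *\<^sub>C vf_apply X p" for X Y :: "'a gn"
  by (simp_all add: vf_apply_def coeff_simps distrib_right sum.distrib mult_scaleC_left cvs.scale_sum_right)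

lemma vf_apply_vf_apply:
  "vf_apply X (vf_apply Y p) =
    (\<Sum>j\<in>UNIV. vf_apply X (coeff Y j) * dd j p)
      + (\<Sum>i\<in>UNIV. \<Sum>j\<in>UNIV. coeff X i * coeff Y j * dd i (dd j p))" for X Y :: "'a gn"
proof -
  have "vf_apply X (vf_apply Y p) = (\<Sum>i\<in>UNIV. \<Sum>j\<in>UNIV. coeff X i * dd i (coeff Y j) * dd j p
      + coeff X i * coeff Y j * dd i (dd j p))"
    by (simp add: vf_apply_def dd_sum dd_mult sum_distrib_left distrib_left ac_simps)
  also have "\<dots> = (\<Sum>i\<in>UNIV. \<Sum>j\<in>UNIV. coeff X i * dd i (coeff Y j) * dd j p)
      + (\<Sum>i\<in>UNIV. \<Sum>j\<in>UNIV. coeff X i * coeff Y j * dd i (dd j p))"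
    by (simp add: sum.distrib)
  also have "(\<Sum>i\<in>UNIV. \<Sum>j\<in>UNIV. coeff X i * dd i (coeff Y j) * dd j p)
      = (\<Sum>j\<in>UNIV. vf_apply X (coeff Y j) * dd j p)"
    by (subst sum.swap) (simp add: vf_apply_def sum_distrib_right)
  finally show ?thesis .
qed

lemma vf_apply_lie:
  "vf_apply (lie X Y) p = vf_apply X (vf_apply Y p) - vf_apply Y (vf_apply X p)" for X Y :: "'a gn"
proof -
  have "(\<Sum>i\<in>UNIV. \<Sum>j\<in>UNIV. coeff X i * coeff Y j * dd i (dd j p))
      = (\<Sum>i\<in>UNIV. \<Sum>j\<in>UNIV. coeff Y i * coeff X j * dd i (dd j p))"
    by (subst sum.swap) (simp add: dd_commute mult.commute)
  then show ?thesis
    unfolding vf_apply_vf_apply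
    by (simp add: vf_apply_def[of "lie X Y"] coeff_simps left_diff_distrib sum_subtractf)
qed

instance
proof
  fix X Y Z :: "'a gn" and c d :: complex
  show "X + Y + Z = X + (Y + Z)" "X + Y = Y + X" "0 + X = X" "- X + X = 0" "X - Y = X + - Y"
    "c *\<^sub>C (X + Y) = c *\<^sub>C X + c *\<^sub>C Y" "(c + d) *\<^sub>C X = c *\<^sub>C X + d *\<^sub>C X"
    "c *\<^sub>C (d *\<^sub>C X) = (c * d) *\<^sub>C X" "1 *\<^sub>C X = X"
    by (simp_all add: coeff_inject[symmetric] fun_eq_iff coeff_simps ac_simps scaleC_add_left
        scaleC_add_right)
  note simps = coeff_inject[symmetric] fun_eq_iff coeff_simps vf_apply_simps vf_apply_add
    vf_apply_scaleC vf_apply_diff vf_apply_lie cvs.scale_right_diff_distrib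
  show "lie (X + Y) Z = lie X Z + lie Y Z" "lie X (Y + Z) = lie X Y + lie X Z"
    "lie (c *\<^sub>C X) Y = c *\<^sub>C lie X Y" "lie X (c *\<^sub>C Y) = c *\<^sub>C lie X Y" "lie X X = 0"
    "lie X (lie Y Z) = lie (lie X Y) Z + lie Y (lie X Z)"
    by (simp_all add: simps)
qed

end

lemma vf_apply_vf: "vf_apply (vf f i) p = f * dd i p"
  by (simp add: vf_apply_def coeff_vf if_distrib[of "\<lambda>x. x * _"] cong: if_cong)

lemma vf_apply_0 [simp]: "vf_apply X 0 = 0"
  by (simp add: vf_apply_def)

lemma lie_vf_vf: "lie (vf f i) (vf g j) = vf (f * dd i g) j - vf (g * dd j f) i"
  by (auto simp: coeff_inject[symmetric] fun_eq_iff coeff_simps vf_apply_vf coeff_vf)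

lemma vf_apply_1: "vf_apply X 1 = 0"
proof -
  have "dd i (1 :: 'a An) = 0" for i
    using dd_mult[of i 1 1] by simp
  then show ?thesis by (simp add: vf_apply_def)
qed

lemma vf_apply_xvar: "vf_apply X (xvar i) = coeff X i"
proof -
  have "(\<lambda>j. if j = i then 1 else 0)(i := 0) = (0 :: 'a \<Rightarrow> nat)" by auto
  then have "dd j (xvar i) = (if j = i then 1 else 0)" for j
    by (auto simp: xvar_def dd_tx tx_0)
  then show ?thesis
    by (simp add: vf_apply_def if_distrib[of "\<lambda>x. _ * x"] cong: if_cong)
qed

lemma inj_vf_apply: "inj vf_apply"
  by (rule injI) (metis vf_apply_xvar coeff_inject ext)

section \<open>The smash product \<open>A\<^sub>n # U(\<gg>\<^sub>n)\<close>\<close>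

text \<open>
  \<open>\<gg>\<^sub>n\<close> acts on \<open>A\<^sub>n \<otimes> U(\<gg>\<^sub>n)\<close> by \<open>X (b \<otimes> v) = X(b) \<otimes> v + b \<otimes> X v\<close>. Extending this action to
  \<open>U(\<gg>\<^sub>n)\<close>, the product of the smash product is \<open>(a \<otimes> u) (b \<otimes> v) = (a \<otimes> 1) (u (b \<otimes> v))\<close>.
\<close>

definition smash_act :: "'n::finite gn \<Rightarrow> ('n An, 'n gn uea) ctensor \<Rightarrow> ('n An, 'n gn uea) ctensor"
  where "smash_act X = tensor_lift (\<lambda>b v. vf_apply X b \<otimes>\<^sub>t v + b \<otimes>\<^sub>t (uea_of X * v))"

definition smash_times :: "('n::finite An, 'n gn uea) ctensor \<Rightarrow> ('n An, 'n gn uea) ctensor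
    \<Rightarrow> ('n An, 'n gn uea) ctensor"
  where "smash_times s t = tensor_lift (\<lambda>a u. (a \<otimes>\<^sub>t 1) * uea_act smash_act u t) s"

lemma cbilinear_smash_act:
  "cbilinear (\<lambda>b v. vf_apply X b \<otimes>\<^sub>t v + b \<otimes>\<^sub>t (uea_of X * v))"
  by (rule cbilinearI)
     (simp_all add: vf_apply_add vf_apply_scaleC tensor_add_left tensor_add_right tensor_scaleC_left
        tensor_scaleC_right distrib_left mult_scaleC_right scaleC_add_right)

lemma smash_act_tensor: "smash_act X (b \<otimes>\<^sub>t v) = vf_apply X b \<otimes>\<^sub>t v + b \<otimes>\<^sub>t (uea_of X * v)"
  by (simp add: smash_act_def tensor_lift_tensor cbilinear_smash_act)

lemmas smash_act_add = tensor_lift_add[OF cbilinear_smash_act, folded smash_act_def]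
  and smash_act_scaleC = tensor_lift_scaleC[OF cbilinear_smash_act, folded smash_act_def]

lemma tensor_diff_left: "(x - x') \<otimes>\<^sub>t y = x \<otimes>\<^sub>t y - x' \<otimes>\<^sub>t y"
  by (metis add_diff_cancel diff_add_cancel tensor_add_left)

lemma tensor_diff_right: "x \<otimes>\<^sub>t (y - y') = x \<otimes>\<^sub>t y - x \<otimes>\<^sub>t y'"
  by (metis add_diff_cancel diff_add_cancel tensor_add_right)

lemma lie_rep_smash_act: "lie_rep smash_act"
  unfolding lie_rep_def
proof (intro conjI allI cbilinearI)
  fix X Y :: "'a gn" and s t :: "('a An, 'a gn uea) ctensor" and c :: complex
  show "smash_act X (s + t) = smash_act X s + smash_act X t"
    "smash_act X (c *\<^sub>C s) = c *\<^sub>C smash_act X s"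
    by (rule smash_act_add smash_act_scaleC)+
  show "smash_act (X + Y) s = smash_act X s + smash_act Y s"
    by (induction s rule: ctensor_induct)
       (simp_all add: smash_act_tensor smash_act_add vf_apply_simps uea_of_simps tensor_add_left
          tensor_add_right distrib_right)
  show "smash_act (c *\<^sub>C X) s = c *\<^sub>C smash_act X s"
    by (induction s rule: ctensor_induct)
       (simp_all add: smash_act_tensor smash_act_add vf_apply_simps uea_of_simps tensor_scaleC_left
          tensor_scaleC_right mult_scaleC_left scaleC_add_right)
  show "smash_act (lie X Y) s = smash_act X (smash_act Y s) - smash_act Y (smash_act X s)"
    by (induction s rule: ctensor_induct)
       (simp_all add: smash_act_tensor smash_act_add vf_apply_lie uea_of_simps tensor_diff_left
          tensor_diff_right left_diff_distrib mult.assoc)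
qed

lemmas smash_uea_act = uea_act_simps[OF lie_rep_smash_act]

lemma cbilinear_smash_times_aux:
  "cbilinear (\<lambda>a u. (a \<otimes>\<^sub>t 1) * uea_act smash_act u t)"
  by (rule cbilinearI)
     (simp_all add: smash_uea_act tensor_add_left tensor_scaleC_left distrib_left distrib_right
        mult_scaleC_left mult_scaleC_right)

lemma smash_times_tensor: "smash_times (a \<otimes>\<^sub>t u) t = (a \<otimes>\<^sub>t 1) * uea_act smash_act u t"
  by (simp add: smash_times_def tensor_lift_tensor cbilinear_smash_times_aux)

lemma smash_times_simps:
  "smash_times (s + s') t = smash_times s t + smash_times s' t"
  "smash_times (c *\<^sub>C s) t = c *\<^sub>C smash_times s t"
  "smash_times s (t + t') = smash_times s t + smash_times s t'"
  "smash_times s (c *\<^sub>C t) = c *\<^sub>C smash_times s t"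
  by (simp_all add: smash_times_def tensor_lift_add[OF cbilinear_smash_times_aux]
      tensor_lift_scaleC[OF cbilinear_smash_times_aux] smash_uea_act distrib_left mult_scaleC_right
      tensor_lift_fun_add tensor_lift_fun_scaleC)

lemma smash_act_left_mult:
  "smash_act X ((a \<otimes>\<^sub>t 1) * t) = (vf_apply X a \<otimes>\<^sub>t 1) * t + (a \<otimes>\<^sub>t 1) * smash_act X t"
  by (induction t rule: ctensor_induct)
     (simp_all add: smash_act_tensor tensor_mult smash_act_add distrib_left vf_apply_mult
        tensor_add_left mult.commute[of _ "vf_apply X a"])

lemma smash_times_act: "smash_times (uea_act smash_act u s) t = uea_act smash_act u (smash_times s t)"
proof (induction u rule: uea_induct)
  case (mult X u)
  have "smash_times (smash_act X s) t = smash_act X (smash_times s t)" for s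
    by (induction s rule: ctensor_induct)
       (simp_all add: smash_act_tensor smash_act_add smash_times_simps smash_times_tensor
          smash_uea_act smash_act_left_mult)
  then show ?case by (simp add: smash_uea_act mult)
qed (simp_all add: smash_uea_act smash_times_simps)

lemma smash_times_left_mult: "smash_times ((a \<otimes>\<^sub>t 1) * s) t = (a \<otimes>\<^sub>t 1) * smash_times s t"
proof (induction s rule: ctensor_induct)
  case (tensor b u)
  have "(a \<otimes>\<^sub>t 1) * (b \<otimes>\<^sub>t u) = (a * b) \<otimes>\<^sub>t u" "(a * b) \<otimes>\<^sub>t 1 = (a \<otimes>\<^sub>t (1 :: 'a gn uea)) * (b \<otimes>\<^sub>t 1)"
    by (simp_all add: tensor_mult)
  then show ?case by (simp add: smash_times_tensor mult.assoc)
qed (simp add: smash_times_simps distrib_left)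

lemma smash_act_one: "uea_act smash_act u (1 \<otimes>\<^sub>t v) = 1 \<otimes>\<^sub>t (u * v)"
proof (induction u rule: uea_induct)
  case (mult X u)
  have "(0 :: 'a An) \<otimes>\<^sub>t w = 0" for w :: "'a gn uea"
    using tensor_scaleC_left[of 0 "0 :: 'a An" w] by simp
  then show ?case
    by (simp add: smash_uea_act mult smash_act_tensor vf_apply_1 mult.assoc)
qed (simp_all add: smash_uea_act distrib_right mult_scaleC_left tensor_add_right tensor_scaleC_right)

typedef 'n smash = "UNIV :: ('n::finite An, 'n gn uea) ctensor set"
  morphisms smash_rep Smash ..

setup_lifting type_definition_smash

instantiation smash :: (finite) complex_algebra
begin

lift_definition zero_smash :: "'a smash" is 0 .
lift_definition one_smash :: "'a smash" is "1 \<otimes>\<^sub>t 1" .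
lift_definition plus_smash :: "'a smash \<Rightarrow> 'a smash \<Rightarrow> 'a smash" is "(+)" .
lift_definition minus_smash :: "'a smash \<Rightarrow> 'a smash \<Rightarrow> 'a smash" is "(-)" .
lift_definition uminus_smash :: "'a smash \<Rightarrow> 'a smash" is uminus .
lift_definition scaleC_smash :: "complex \<Rightarrow> 'a smash \<Rightarrow> 'a smash" is scaleC .
lift_definition times_smash :: "'a smash \<Rightarrow> 'a smash \<Rightarrow> 'a smash" is smash_times .

instance
proof
  fix x y z :: "'a smash" and c d :: complex
  show "x + y + z = x + (y + z)" "x + y = y + x" "0 + x = x" "- x + x = 0" "x - y = x + - y"
    "c *\<^sub>C (x + y) = c *\<^sub>C x + c *\<^sub>C y" "(c + d) *\<^sub>C x = c *\<^sub>C x + d *\<^sub>C x"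
    "c *\<^sub>C (d *\<^sub>C x) = (c * d) *\<^sub>C x" "1 *\<^sub>C x = x"
    by (transfer; simp add: ac_simps scaleC_add_left scaleC_add_right)+
  show "(x + y) * z = x * z + y * z" "x * (y + z) = x * y + x * z"
    "(c *\<^sub>C x) * y = c *\<^sub>C (x * y)" "x * (c *\<^sub>C y) = c *\<^sub>C (x * y)"
    by (transfer; simp add: smash_times_simps)+
  show "(0 :: 'a smash) \<noteq> 1"
    by transfer (use tensor_nonzero[of "1 :: 'a An" "1 :: 'a gn uea"] in simp)
  show "1 * x = x"
    by transfer (unfold smash_times_tensor smash_uea_act, simp flip: one_ctensor_def)
  show "x * 1 = x"
  proof transfer
    fix s :: "('a An, 'a gn uea) ctensor"
    show "smash_times s (1 \<otimes>\<^sub>t 1) = s"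
      by (induction s rule: ctensor_induct)
         (simp_all add: smash_times_tensor smash_times_simps smash_act_one tensor_mult)
  qed
  show "x * y * z = x * (y * z)"
  proof transfer
    fix r s t :: "('a An, 'a gn uea) ctensor"
    show "smash_times (smash_times r s) t = smash_times r (smash_times s t)"
      by (induction r rule: ctensor_induct)
         (simp_all add: smash_times_tensor smash_times_simps smash_times_left_mult smash_times_act)
  qed
qed

end

definition smash_of_A :: "'n::finite An \<Rightarrow> 'n smash"
  where "smash_of_A f = Smash (f \<otimes>\<^sub>t 1)"

definition smash_of_U :: "'n::finite gn uea \<Rightarrow> 'n smash"
  where "smash_of_U u = Smash (1 \<otimes>\<^sub>t u)"

abbreviation smash_of_g :: "'n::finite gn \<Rightarrow> 'n smash"
  where "smash_of_g X \<equiv> smash_of_U (uea_of X)"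

lemma Smash_times: "Smash s * Smash t = Smash (smash_times s t)"
  by (simp add: times_smash.abs_eq eq_onp_def)

lemma smash_of_A_1: "smash_of_A 1 = 1"
  by (simp add: smash_of_A_def one_smash_def)

lemma smash_of_U_1: "smash_of_U 1 = 1"
  by (simp add: smash_of_U_def one_smash_def)

lemma smash_of_A_mult: "smash_of_A (f * g) = smash_of_A f * smash_of_A g"
  by (simp add: smash_of_A_def Smash_times smash_times_tensor smash_uea_act tensor_mult)

lemma smash_of_U_mult: "smash_of_U (u * v) = smash_of_U u * smash_of_U v"
  by (simp add: smash_of_U_def Smash_times smash_times_tensor smash_act_one tensor_mult)

lemma smash_of_A_times_U: "smash_of_A f * smash_of_U u = Smash (f \<otimes>\<^sub>t u)"
  by (simp add: smash_of_A_def smash_of_U_def Smash_times smash_times_tensor smash_uea_act tensor_mult)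

lemma smash_relation:
  "smash_of_g X * smash_of_A f = smash_of_A f * smash_of_g X + smash_of_A (vf_apply X f)"
  unfolding smash_of_A_times_U
  by (simp add: smash_of_A_def smash_of_U_def Smash_times smash_times_tensor smash_uea_act
      smash_act_tensor tensor_mult plus_smash.abs_eq eq_onp_def distrib_left add.commute)

lemma inj_smash_of_A: "inj smash_of_A"
proof (rule injI)
  fix f g :: "'n::finite An"
  assume "smash_of_A f = smash_of_A g"
  then have "(f - g) \<otimes>\<^sub>t (1 :: 'n gn uea) = 0"
    by (simp add: smash_of_A_def Smash_inject tensor_diff_left)
  then show "f = g" using tensor_nonzero[of "f - g" "1 :: 'n gn uea"] by auto
qed

lemma inj_smash_of_U: "inj smash_of_U"
proof (rule injI)
  fix u v :: "'n::finite gn uea"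
  assume "smash_of_U u = smash_of_U v"
  then have "(1 :: 'n An) \<otimes>\<^sub>t (u - v) = 0"
    by (simp add: smash_of_U_def Smash_inject tensor_diff_right)
  then show "u = v" using tensor_nonzero[of "1 :: 'n An" "u - v"] by auto
qed

section \<open>The subalgebra \<open>D\<^sub>n\<close>\<close>

definition Dn_set :: "'n::finite smash set"
  where "Dn_set = subalgebra hull (range smash_of_A \<union> range (\<lambda>i. smash_of_g (vf 1 i)))"

lemma subalgebra_Dn_set: "subalgebra Dn_set"
  unfolding Dn_set_def by (rule hull_in) (unfold subalgebra_def, blast)

lemma smash_of_A_in_Dn [simp]: "smash_of_A f \<in> Dn_set"
  and smash_of_d_in_Dn [simp]: "smash_of_g (vf 1 i) \<in> Dn_set"
  unfolding Dn_set_def by (rule set_mp[OF hull_subset], blast)+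

lemma Dn_set_closed:
  "1 \<in> Dn_set" "x \<in> Dn_set \<Longrightarrow> y \<in> Dn_set \<Longrightarrow> x + y \<in> Dn_set"
  "x \<in> Dn_set \<Longrightarrow> y \<in> Dn_set \<Longrightarrow> x * y \<in> Dn_set" "x \<in> Dn_set \<Longrightarrow> c *\<^sub>C x \<in> Dn_set"
  using subalgebra_Dn_set unfolding subalgebra_def by blast+

lemma Dn_set_uminus: "x \<in> Dn_set \<Longrightarrow> - x \<in> Dn_set"
  by (subst scaleC_uminus) (rule Dn_set_closed)

lemma Dn_set_0: "0 \<in> Dn_set"
  using Dn_set_closed(4)[OF Dn_set_closed(1), of 0] by simp

typedef 'n Dn = "Dn_set :: 'n::finite smash set"
  morphisms Dn_rep Dn_abs
  using smash_of_A_in_Dn by blast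

setup_lifting type_definition_Dn

instantiation Dn :: (finite) complex_algebra
begin

lift_definition zero_Dn :: "'a Dn" is 0
  by (rule Dn_set_0)
lift_definition one_Dn :: "'a Dn" is 1
  by (rule Dn_set_closed)
lift_definition plus_Dn :: "'a Dn \<Rightarrow> 'a Dn \<Rightarrow> 'a Dn" is "(+)"
  by (rule Dn_set_closed)
lift_definition minus_Dn :: "'a Dn \<Rightarrow> 'a Dn \<Rightarrow> 'a Dn" is "(-)"
  unfolding diff_conv_add_uminus by (intro Dn_set_closed Dn_set_uminus)
lift_definition uminus_Dn :: "'a Dn \<Rightarrow> 'a Dn" is uminus
  by (rule Dn_set_uminus)
lift_definition times_Dn :: "'a Dn \<Rightarrow> 'a Dn \<Rightarrow> 'a Dn" is "(*)"
  by (rule Dn_set_closed)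
lift_definition scaleC_Dn :: "complex \<Rightarrow> 'a Dn \<Rightarrow> 'a Dn" is scaleC
  by (rule Dn_set_closed)

instance
  by standard (transfer; simp add: algebra_simps scaleC_add_left scaleC_add_right mult_scaleC_left
      mult_scaleC_right)+

end

definition Dn_of_A :: "'n::finite An \<Rightarrow> 'n Dn"
  where "Dn_of_A f = Dn_abs (smash_of_A f)"

definition Dn_d :: "'n::finite \<Rightarrow> 'n Dn"
  where "Dn_d i = Dn_abs (smash_of_g (vf 1 i))"

section \<open>The Lie subalgebra \<open>\<mm>\<^sub>1\<^sub>,\<^sub>0\<Delta>\<close>\<close>

text \<open>The span of a set over the ring itself is the ideal generated by it.\<close>

definition m10 :: "'n An set"
  where "m10 = module.span (*) (range (\<lambda>i. tvar i - 1) \<union> range xvar)"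

interpretation An_module: module "(*) :: 'n An \<Rightarrow> 'n An \<Rightarrow> 'n An"
  by unfold_locales (simp_all add: algebra_simps)

lemma m10_closed:
  "0 \<in> m10" "p \<in> m10 \<Longrightarrow> q \<in> m10 \<Longrightarrow> p + q \<in> m10" "p \<in> m10 \<Longrightarrow> q \<in> m10 \<Longrightarrow> p - q \<in> m10"
  "p \<in> m10 \<Longrightarrow> f * p \<in> m10" "p \<in> m10 \<Longrightarrow> p * f \<in> m10" "p \<in> m10 \<Longrightarrow> - p \<in> m10"
  "p \<in> m10 \<Longrightarrow> c *\<^sub>C p \<in> m10"
proof -
  show m: "p \<in> m10 \<Longrightarrow> f * p \<in> m10" for f
    unfolding m10_def by (rule An_module.span_scale)
  from m[of "c *\<^sub>C 1"] show "p \<in> m10 \<Longrightarrow> c *\<^sub>C p \<in> m10"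
    by (simp add: mult_scaleC_left)
  from m[of f] show "p \<in> m10 \<Longrightarrow> p * f \<in> m10" by (simp add: mult.commute)
qed (auto simp: m10_def An_module.span_zero An_module.span_add An_module.span_diff An_module.span_neg)

lemma lie_m10:
  assumes "\<forall>i. coeff X i \<in> m10" "\<forall>i. coeff Y i \<in> m10"
  shows "coeff (lie X Y) i \<in> m10"
proof -
  have "vf_apply X p \<in> m10" "vf_apply Y p \<in> m10" for p
    using assms unfolding vf_apply_def m10_def
    by (auto intro!: An_module.span_sum m10_closed(5)[unfolded m10_def])
  then show ?thesis by (simp add: coeff_simps m10_closed)
qed

typedef 'n mDelta = "{X :: 'n::finite gn. \<forall>i. coeff X i \<in> m10}"
  morphisms mDelta_rep mDelta_abs
  by (rule exI[of _ 0]) (simp add: coeff_simps m10_closed)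

setup_lifting type_definition_mDelta

instantiation mDelta :: (finite) lie_algebra
begin

lift_definition zero_mDelta :: "'a mDelta" is 0
  by (simp add: coeff_simps m10_closed)
lift_definition plus_mDelta :: "'a mDelta \<Rightarrow> 'a mDelta \<Rightarrow> 'a mDelta" is "(+)"
  by (simp add: coeff_simps m10_closed)
lift_definition minus_mDelta :: "'a mDelta \<Rightarrow> 'a mDelta \<Rightarrow> 'a mDelta" is "(-)"
  by (simp add: coeff_simps m10_closed)
lift_definition uminus_mDelta :: "'a mDelta \<Rightarrow> 'a mDelta" is uminus
  by (simp add: coeff_simps m10_closed)
lift_definition scaleC_mDelta :: "complex \<Rightarrow> 'a mDelta \<Rightarrow> 'a mDelta" is scaleC
  by (simp add: coeff_simps m10_closed)
lift_definition lie_mDelta :: "'a mDelta \<Rightarrow> 'a mDelta \<Rightarrow> 'a mDelta" is lie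
  by (simp add: lie_m10)

instance
proof
  fix X Y Z :: "'a mDelta" and c d :: complex
  show "X + Y + Z = X + (Y + Z)" "X + Y = Y + X" "0 + X = X" "- X + X = 0" "X - Y = X + - Y"
    "c *\<^sub>C (X + Y) = c *\<^sub>C X + c *\<^sub>C Y" "(c + d) *\<^sub>C X = c *\<^sub>C X + d *\<^sub>C X"
    "c *\<^sub>C (d *\<^sub>C X) = (c * d) *\<^sub>C X" "1 *\<^sub>C X = X"
    "lie (X + Y) Z = lie X Z + lie Y Z" "lie X (Y + Z) = lie X Y + lie X Z"
    "lie (c *\<^sub>C X) Y = c *\<^sub>C lie X Y" "lie X (c *\<^sub>C Y) = c *\<^sub>C lie X Y" "lie X X = 0"
    by (transfer; simp add: ac_simps scaleC_add_left scaleC_add_right lie_add_left lie_add_right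
        lie_scaleC_left lie_scaleC_right lie_self)+
  show "lie X (lie Y Z) = lie (lie X Y) Z + lie Y (lie X Z)"
    by transfer (rule jacobi)
qed

end

lemma tx_m10:
  fixes a :: "'n::finite \<Rightarrow> int"
  shows "tx a r - (if r = 0 then 1 else 0) \<in> m10"
proof (cases "r = 0")
  case False
  then obtain i where i: "r i \<noteq> 0" by (auto simp: fun_eq_iff)
  have "r(i := r i - 1) + (\<lambda>j. if j = i then 1 else 0) = r"
    using i by (auto simp: fun_eq_iff)
  then have "tx a r = tx a (r(i := r i - 1)) * xvar i"
    by (simp add: xvar_def tx_mult)
  moreover have "xvar i \<in> m10"
    unfolding m10_def by (rule An_module.span_base) simp
  ultimately show ?thesis using False by (simp add: m10_closed)
next
  case True
  have mult: "p * q - 1 \<in> m10" if "p - 1 \<in> m10" "q - 1 \<in> m10" for p q :: "'n An"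
  proof -
    have "p * q - 1 = (p - 1) * q + (q - 1)" by (simp add: algebra_simps)
    then show ?thesis using that by (simp only: m10_closed)
  qed
  have inv: "q - 1 \<in> m10" if "p - 1 \<in> m10" "q * p = 1" for p q :: "'n An"
  proof -
    have "q - 1 = - (q * (p - 1))" using that by (simp add: algebra_simps)
    then show ?thesis using that by (simp only: m10_closed)
  qed
  have nat: "tx (\<lambda>j. if j = i then int k else 0) 0 - 1 \<in> m10" for i :: 'n and k
  proof (induction k)
    case 0
    have "(\<lambda>j. if j = i then int 0 else 0) = 0" by auto
    then show ?case by (simp only: tx_0 diff_self m10_closed)
  next
    case (Suc k)
    have "(\<lambda>j. if j = i then int (Suc k) else 0)
        = (\<lambda>j. if j = i then 1 else 0) + (\<lambda>j. if j = i then int k else 0)"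
      by auto
    then have "tx (\<lambda>j. if j = i then int (Suc k) else 0) 0
        = tvar i * tx (\<lambda>j. if j = i then int k else 0) 0"
      by (simp add: tvar_def tx_mult)
    moreover have "tvar i - 1 \<in> m10"
      unfolding m10_def by (rule An_module.span_base) simp
    ultimately show ?case using Suc.IH by (simp only: mult)
  qed
  have int: "tx (\<lambda>j. if j = i then k else 0) 0 - 1 \<in> m10" for i :: 'n and k
  proof (cases "k \<ge> 0")
    case True
    with nat[of i "nat k"] show ?thesis by (simp only: nat_0_le)
  next
    case False
    have "(\<lambda>j. if j = i then k else 0) + (\<lambda>j. if j = i then int (nat (- k)) else 0) = 0"
      using False by auto
    then show ?thesis
      by (intro inv[OF nat[of i "nat (- k)"]]) (simp only: tx_mult tx_0 add_0)
  qed
  have "tx (\<lambda>j. if j \<in> S then a j else 0) 0 - 1 \<in> m10" if "finite S" for S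
    using that
  proof induction
    case empty
    have "(\<lambda>j. if j \<in> {} then a j else 0) = 0" by auto
    then show ?case by (simp only: tx_0 diff_self m10_closed)
  next
    case (insert i S)
    have "(\<lambda>j. if j \<in> insert i S then a j else 0)
        = (\<lambda>j. if j = i then a i else 0) + (\<lambda>j. if j \<in> S then a j else 0)"
      using insert by auto
    then have "tx (\<lambda>j. if j \<in> insert i S then a j else 0) 0
        = tx (\<lambda>j. if j = i then a i else 0) 0 * tx (\<lambda>j. if j \<in> S then a j else 0) 0"
      by (simp add: tx_mult)
    then show ?case using mult[OF int insert.IH] by (simp only:)
  qed
  from this[of UNIV] True show ?thesis by simp
qed

text \<open>So \<open>t\<^sup>a x\<^sup>r d\<^sub>i - \<delta>\<^sub>r\<^sub>,\<^sub>0 d\<^sub>i\<close> lies in \<open>\<mm>\<^sub>1\<^sub>,\<^sub>0\<Delta>\<close>, and \<open>mDelta_abs\<close> may be applied to it.\<close>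

lemma mDelta_rep_abs:
  fixes a :: "'n::finite \<Rightarrow> int"
  defines "X \<equiv> \<lambda>r i. vf (tx a r) i - (if r = 0 then vf 1 i else 0)"
  shows "mDelta_rep (mDelta_abs (X r i)) = X r i"
  by (rule mDelta_abs_inverse) (use tx_m10[of a r] in \<open>auto simp: X_def coeff_simps coeff_vf m10_closed\<close>)

end

theory Submission
  imports Defs "HOL-Library.FuncSet"
begin

text \<open>
  \<open>A\<^sub>n\<close> is the algebra of functions on the commutative group \<open>G = \<complex>\<^sup>\<times>\<^sup>n \<times> \<complex>\<^sup>n\<close> with coordinates \<open>t\<close> and
  \<open>x\<close>, the \<open>d\<^sub>i\<close> are translation invariant vector fields, and the ideal \<open>m10\<close> consists of the
  functions that vanish at the neutral element \<open>1\<close>. Moving a vector field \<open>h d\<^sub>i\<close> with \<open>h(1) = 0\<close>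
  by a point \<open>y\<close> of \<open>G\<close> gives \<open>h(y\<^sup>-\<^sup>1 z) d\<^sub>i\<close>, which vanishes at \<open>z = y\<close>. Expanding it as a sum of
  \<open>f(y) g(z) d\<^sub>i\<close> and sending each term to the product \<open>f \<cdot> (g d\<^sub>i)\<close> defines an element \<open>theta\<close> of the smash
  product. It commutes with \<open>A\<^sub>n\<close> because the function vanishes on the diagonal, and with every
  \<open>d\<^sub>j\<close> because \<open>y\<^sup>-\<^sup>1 z\<close> does not change when \<open>y\<close> and \<open>z\<close> are translated together
  (\<open>theta_commutes_Dn\<close>). Because these elements commute with the coefficients in \<open>A\<^sub>n\<close>, their
  commutators are governed by the brackets of the vector fields alone, and \<open>theta\<close> is a Lie map
  of \<open>\<mm>\<^sub>1\<^sub>,\<^sub>0\<Delta>\<close> to the centralizer of \<open>D\<^sub>n\<close> (\<open>theta_lie\<close>). It induces a homomorphism \<open>psi\<close> from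
  \<open>D\<^sub>n \<otimes> U(\<mm>\<^sub>1\<^sub>,\<^sub>0\<Delta>)\<close> to the smash product.

  In the other direction, write \<open>f(y z)\<close> as a sum of \<open>f\<^sub>1(y) f\<^sub>2(z)\<close>. The formula of the theorem says that
  \<open>f d\<^sub>i\<close> goes to the sum of \<open>f\<^sub>1 \<otimes> (f\<^sub>2 - f\<^sub>2(1)) d\<^sub>i\<close>, plus \<open>f \<cdot> d\<^sub>i \<otimes> 1\<close>; the binomial coefficients
  are those of \<open>x\<^sub>j \<mapsto> x\<^sub>j \<otimes> 1 + 1 \<otimes> x\<^sub>j\<close> (\<open>translate_binomial\<close>). That this is a Lie map
  (\<open>phi_g_lie\<close>) follows from the invariance of the \<open>d\<^sub>i\<close>, and the universal property of the smash
  product then gives the homomorphism \<open>phi\<close>. Finally \<open>phi\<close> and \<open>psi\<close> are inverse to each other because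
  the substitutions \<open>(y, z) \<mapsto> (y, y z)\<close> and \<open>(y, z) \<mapsto> (y, y\<^sup>-\<^sup>1 z)\<close> are, which is the case
  \<open>s + s' = 0\<close> of \<open>shear_translate\<close>. Both composites are homomorphisms, so that this is
  compared on generators only.
\<close>

section \<open>Tensor products of commutative algebras\<close>

lemma clinear_sum: "clinear f \<Longrightarrow> f (sum g S) = (\<Sum>i\<in>S. f (g i))"
  by (induction S rule: infinite_finite_induct) (simp_all add: clinear_0 clinear_add)

lemma tensor_clinear_left: "clinear (\<lambda>x. x \<otimes>\<^sub>t y)"
  and tensor_clinear_right: "clinear ((\<otimes>\<^sub>t) x)"
  using cbilinear_tensor unfolding cbilinear_def by auto

lemmas tensor_0_left [simp] = clinear_0[OF tensor_clinear_left]
  and tensor_0_right [simp] = clinear_0[OF tensor_clinear_right]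

lemma tensor_one_power: "(a \<otimes>\<^sub>t 1) ^ k = a ^ k \<otimes>\<^sub>t (1 :: 'b::complex_algebra)"
  "((1 :: 'b) \<otimes>\<^sub>t a) ^ k = 1 \<otimes>\<^sub>t a ^ k" for a :: "'a::complex_algebra"
  by (induction k) (simp_all add: one_ctensor_def tensor_mult)

text \<open>
  Commutativity of \<open>A\<^sub>n \<otimes> A\<^sub>n\<close> is wanted as an instance, because it gives access to products over
  the index set and to the binomial theorem.
\<close>

class complex_comm_algebra = complex_algebra + comm_ring_1

instance complex :: complex_comm_algebra ..

instance poly_mapping :: (comm_monoid_add, complex_comm_algebra) complex_comm_algebra ..

instance ctensor :: (complex_comm_algebra, complex_comm_algebra) complex_comm_algebra
proof
  fix s t u :: "('a, 'b) ctensor"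
  show "s * t = t * s"
  proof (induction s rule: ctensor_induct)
    case (tensor a b)
    show ?case
      by (induction t rule: ctensor_induct)
        (simp_all add: tensor_mult mult.commute distrib_left distrib_right)
  qed (simp add: distrib_left distrib_right)
qed (simp_all add: distrib_right)

section \<open>Pulling functions back along \<open>(y, z) \<mapsto> y\<^sup>s z\<close>\<close>

text \<open>
  Identities between homomorphisms or derivations on \<open>A\<^sub>n\<close> are checked with this rule on \<open>t\<^sup>a\<close> and
  \<open>x\<^sub>j\<close> alone, which keeps binomial sums out of the proofs.
\<close>

lemma An_induct_gen [case_names t x add scale]:
  fixes p :: "'n::finite An"
  assumes t: "\<And>a. P (tx a 0)" and x: "\<And>j p. P p \<Longrightarrow> P (xvar j * p)"
    and add: "\<And>p q. P p \<Longrightarrow> P q \<Longrightarrow> P (p + q)" and scale: "\<And>c p. P p \<Longrightarrow> P (c *\<^sub>C p)"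
  shows "P p"
proof (induction p rule: An_induct)
  case (tx a m)
  show ?case
  proof (induction "\<Sum>i\<in>UNIV. m i" arbitrary: m rule: less_induct)
    case less
    show ?case
    proof (cases "m = 0")
      case False
      then obtain i where i: "m i \<noteq> 0" by (auto simp: fun_eq_iff)
      let ?k = "m(i := m i - 1)"
      have "(\<lambda>j. if j = i then 1 else 0) + ?k = m"
        using i by (auto simp: fun_eq_iff)
      then have m: "tx a m = xvar i * tx a ?k"
        by (simp only: xvar_def tx_mult add_0)
      have "(\<Sum>j\<in>UNIV. ?k j) < (\<Sum>j\<in>UNIV. m j)"
        using i by (intro sum_strict_mono_ex1) auto
      from x[OF less[OF this], of i] show ?thesis
        by (simp only: m)
    qed (use t in simp)
  qed
qed (use add scale in auto)

lemma dd_1 [simp]: "dd i 1 = 0"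
  using dd_mult[of i 1 1] by simp

lemma dd_t: "dd i (tx a 0) = of_int (a i) *\<^sub>C tx a 0"
  by (simp add: dd_tx)

lemma dd_xvar: "dd i (xvar j) = (if i = j then 1 else 0)"
proof -
  have "(\<lambda>k. if k = j then 1 else 0)(j := 0) = (0 :: 'a \<Rightarrow> nat)" by auto
  then show ?thesis by (auto simp: xvar_def dd_tx tx_0)
qed

text \<open>
  Evaluation at the neutral element \<open>(1, 0)\<close>; its kernel is the ideal \<open>m10\<close>.
\<close>

definition counit :: "'n::finite An \<Rightarrow> complex"
  where "counit = lin_ext (\<lambda>(a, m). if m = 0 then 1 else 0)"

lemma counit_linear: "clinear counit"
  unfolding counit_def by (rule lin_ext_linear)

lemmas counit_add = clinear_add[OF counit_linear]
  and counit_scaleC = clinear_scaleC[OF counit_linear]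
  and counit_diff = clinear_diff[OF counit_linear]
  and counit_0 = clinear_0[OF counit_linear]

lemma counit_tx: "counit (tx a m) = (if m = 0 then 1 else 0)"
  by (simp add: counit_def tx_def lin_ext_single scaleC_complex_def)

lemma counit_1 [simp]: "counit 1 = 1"
  by (simp add: counit_tx flip: tx_0)

lemma counit_xvar: "counit (xvar i) = 0"
  by (simp add: xvar_def counit_tx fun_eq_iff)

lemma counit_mult: "counit (p * q) = counit p * counit q"
proof (induction p rule: An_induct)
  case (tx a m)
  show ?case
    by (induction q rule: An_induct)
      (auto simp: tx_mult counit_tx distrib_left mult_scaleC_right counit_add counit_scaleC
        fun_eq_iff scaleC_complex_def)
qed (simp_all add: distrib_right mult_scaleC_left counit_add counit_scaleC)

type_synonym 'n An2 = "('n An, 'n An) ctensor"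

text \<open>
  \<open>translate s f\<close> is the function \<open>f(y\<^sup>s z)\<close> of two points \<open>y\<close>, \<open>z\<close> of the group
  \<open>G = \<complex>\<^sup>\<times>\<^sup>n \<times> \<complex>\<^sup>n\<close>, with \<open>y\<close> in the left and \<open>z\<close> in the right tensor factor: a coordinate \<open>t\<^sub>j\<close>
  becomes \<open>t\<^sub>j\<^sup>s \<otimes> t\<^sub>j\<close> and a coordinate \<open>x\<^sub>j\<close> becomes \<open>1 \<otimes> x\<^sub>j + s x\<^sub>j \<otimes> 1\<close>. For \<open>s = 1\<close> this is the
  comultiplication of the Hopf algebra \<open>A\<^sub>n\<close>; for \<open>s = - 1\<close> it is the comultiplication followed by the
  antipode on the left. Treating all \<open>s\<close> at once turns the antipode axiom and coassociativity
  into the single rule \<open>shear_translate\<close> below.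
\<close>

definition translate_xvar :: "int \<Rightarrow> 'n::finite \<Rightarrow> 'n An2"
  where "translate_xvar s j = 1 \<otimes>\<^sub>t xvar j + of_int s *\<^sub>C (xvar j \<otimes>\<^sub>t 1)"

definition translate :: "int \<Rightarrow> 'n::finite An \<Rightarrow> 'n An2"
  where "translate s = lin_ext (\<lambda>(a, m).
    (tx (\<lambda>j. s * a j) 0 \<otimes>\<^sub>t tx a 0) * (\<Prod>j\<in>UNIV. translate_xvar s j ^ m j))"

lemma translate_linear: "clinear (translate s)"
  unfolding translate_def by (rule lin_ext_linear)

lemmas translate_add = clinear_add[OF translate_linear]
  and translate_scaleC = clinear_scaleC[OF translate_linear]
  and translate_diff = clinear_diff[OF translate_linear]

lemma translate_tx:
  "translate s (tx a m) =
    (tx (\<lambda>j. s * a j) 0 \<otimes>\<^sub>t tx a 0) * (\<Prod>j\<in>UNIV. translate_xvar s j ^ m j)"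
  by (simp add: translate_def tx_def[of a m] lin_ext_single scaleC_one)

lemma translate_t: "translate s (tx a 0) = tx (\<lambda>j. s * a j) 0 \<otimes>\<^sub>t tx a 0"
  by (simp add: translate_tx)

lemma translate_1: "translate s 1 = 1"
proof -
  have "(\<lambda>j. s * (0 :: 'a \<Rightarrow> int) j) = 0" by auto
  then show ?thesis
    using translate_t[of s "0 :: 'a \<Rightarrow> int"] by (simp add: tx_0 one_ctensor_def)
qed

lemma translate_x: "translate s (xvar j) = translate_xvar s j"
proof -
  have 0: "(\<lambda>j. s * (0 :: 'a \<Rightarrow> int) j) = 0" by auto
  have "(\<Prod>k\<in>UNIV. translate_xvar s k ^ (if k = j then 1 else 0)) = translate_xvar s j"
    by (simp add: if_distrib[of "\<lambda>m. _ ^ m"] cong: if_cong)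
  then show ?thesis
    by (simp only: xvar_def translate_tx 0 tx_0 mult_1 flip: one_ctensor_def)
qed

lemma translate_mult: "translate s (p * q) = translate s p * translate s q"
proof (induction p rule: An_induct)
  case (tx a m)
  show ?case
  proof (induction q rule: An_induct)
    case (tx b k)
    have "(\<lambda>j. s * (a + b) j) = (\<lambda>j. s * a j) + (\<lambda>j. s * b j)"
      by (auto simp: distrib_left)
    then have "tx (\<lambda>j. s * (a + b) j) 0 \<otimes>\<^sub>t tx (a + b) 0
        = (tx (\<lambda>j. s * a j) 0 \<otimes>\<^sub>t tx a 0) * (tx (\<lambda>j. s * b j) 0 \<otimes>\<^sub>t tx b 0)"
      by (simp add: tensor_mult tx_mult)
    then show ?case
      by (simp add: tx_mult translate_tx power_add prod.distrib)
  qed (simp_all add: distrib_left mult_scaleC_right translate_add translate_scaleC)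
qed (simp_all add: distrib_right mult_scaleC_left translate_add translate_scaleC)

lemma tx_x_power: "xvar j ^ k = tx 0 (\<lambda>i. if i = j then k else 0)"
proof (induction k)
  case 0
  have "(\<lambda>i. if i = j then 0 else 0) = (0 :: 'a \<Rightarrow> nat)" by auto
  then show ?case by (simp only: tx_0 power_0)
next
  case (Suc k)
  have "(\<lambda>i. if i = j then 1 else 0) + (\<lambda>i. if i = j then k else 0)
      = (\<lambda>i. if i = j then Suc k else 0)"
    by auto
  then show ?case unfolding power_Suc Suc by (simp only: xvar_def tx_mult add_0)
qed

lemma tx_prod: "(\<Prod>j\<in>S. tx 0 (m j)) = tx 0 (\<lambda>i. \<Sum>j\<in>S. m j i)"
proof (induction S rule: infinite_finite_induct)
  case (insert j S)
  have "m j + (\<lambda>i. \<Sum>j\<in>S. m j i) = (\<lambda>i. \<Sum>j\<in>insert j S. m j i)"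
    using insert by auto
  moreover have "(\<Prod>j\<in>insert j S. tx 0 (m j)) = tx 0 (m j) * tx 0 (\<lambda>i. \<Sum>j\<in>S. m j i)"
    unfolding prod.insert[OF insert.hyps] insert.IH ..
  ultimately show ?case by (simp only: tx_mult add_0)
qed (simp_all add: tx_0 flip: zero_fun_def)

lemma prod_xvar: "(\<Prod>j\<in>UNIV. xvar j ^ m j) = tx 0 m" for m :: "'n::finite \<Rightarrow> nat"
  by (simp add: tx_x_power tx_prod)

lemma tensor_prod: "(\<Prod>j\<in>S. f j \<otimes>\<^sub>t g j) = (\<Prod>j\<in>S. f j) \<otimes>\<^sub>t (\<Prod>j\<in>S. g j)"
  for f :: "'i \<Rightarrow> 'a::complex_comm_algebra" and g :: "'i \<Rightarrow> 'b::complex_comm_algebra"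
  by (induction S rule: infinite_finite_induct) (simp_all add: tensor_mult one_ctensor_def)

lemma scaleC_of_nat: "of_nat k *\<^sub>C x = of_nat k * (x :: 'a::complex_algebra)"
  by (induction k) (simp_all add: scaleC_add_left distrib_right scaleC_one)

text \<open>
  The binomial sum in the formula for the isomorphism is the comultiplication of \<open>t\<^sup>a x\<^sup>m\<close>,
  because \<open>x\<^sub>j\<close> is primitive.
\<close>

lemma translate_binomial:
  fixes a :: "'n::finite \<Rightarrow> int"
  shows "translate 1 (tx a m) = (\<Sum>r\<in>{r. \<forall>j. r j \<le> m j}.
    of_nat (\<Prod>j\<in>UNIV. m j choose r j) *\<^sub>C (tx a (\<lambda>j. m j - r j) \<otimes>\<^sub>t tx a r))"
proof -
  have pow: "translate_xvar 1 j ^ k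
      = (\<Sum>r\<le>k. of_nat (k choose r) * (xvar j ^ (k - r) \<otimes>\<^sub>t xvar j ^ r))" for j :: 'n and k
    by (simp add: translate_xvar_def scaleC_one binomial_ring mult.assoc tensor_one_power tensor_mult)
  have PiE: "(\<Pi>\<^sub>E j\<in>UNIV. {..m j}) = {r. \<forall>j. r j \<le> m j}"
    by (auto simp: PiE_iff)
  have "(\<Prod>j\<in>UNIV. translate_xvar 1 j ^ m j) = (\<Sum>r\<in>{r. \<forall>j. r j \<le> m j}.
      \<Prod>j\<in>UNIV. of_nat (m j choose r j) * (xvar j ^ (m j - r j) \<otimes>\<^sub>t xvar j ^ r j))"
    unfolding pow by (subst prod_sum_PiE) (simp_all only: PiE finite finite_atMost)
  also have "\<dots> = (\<Sum>r\<in>{r. \<forall>j. r j \<le> m j}.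
      of_nat (\<Prod>j\<in>UNIV. m j choose r j) *\<^sub>C (tx 0 (\<lambda>j. m j - r j) \<otimes>\<^sub>t tx 0 r))"
    unfolding scaleC_of_nat
    by (simp add: prod.distrib tensor_prod prod_xvar)
  finally show ?thesis
    by (simp add: translate_tx sum_distrib_left mult_scaleC_right tensor_mult tx_mult)
qed

section \<open>Operators on \<open>A\<^sub>n \<otimes> A\<^sub>n\<close>\<close>

lemma cbilinear_comp:
  assumes "clinear f" "clinear g" "cbilinear B"
  shows "cbilinear (\<lambda>x y. B (f x) (g y))"
  by (rule cbilinearI)
    (simp_all add: clinear_add[OF assms(1)] clinear_scaleC[OF assms(1)]
      clinear_add[OF assms(2)] clinear_scaleC[OF assms(2)] cbilinearD[OF assms(3)])

lemma clinear_id: "clinear (\<lambda>x. x)"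
  by (rule clinearI) simp_all

definition dd_left :: "'n::finite \<Rightarrow> 'n An2 \<Rightarrow> 'n An2"
  where "dd_left i = tensor_lift (\<lambda>f g. dd i f \<otimes>\<^sub>t g)"

definition dd_right :: "'n::finite \<Rightarrow> 'n An2 \<Rightarrow> 'n An2"
  where "dd_right i = tensor_lift (\<lambda>f g. f \<otimes>\<^sub>t dd i g)"

definition An_mult :: "'n::finite An2 \<Rightarrow> 'n An"
  where "An_mult = tensor_lift (*)"

definition counit_right :: "'n::finite An2 \<Rightarrow> 'n An"
  where "counit_right = tensor_lift (\<lambda>f g. counit g *\<^sub>C f)"

text \<open>
  The algebra endomorphism of \<open>A\<^sub>n \<otimes> A\<^sub>n\<close> given by the substitution \<open>(y, z) \<mapsto> (y, y\<^sup>s z)\<close>. It is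
  invertible with inverse \<open>shear (- s)\<close>.
\<close>

definition shear :: "int \<Rightarrow> 'n::finite An2 \<Rightarrow> 'n An2"
  where "shear s = tensor_lift (\<lambda>f g. (f \<otimes>\<^sub>t 1) * translate s g)"

lemma cbilinear_dd_left: "cbilinear (\<lambda>f (g :: 'n::finite An). dd i (f :: 'n An) \<otimes>\<^sub>t g)"
  and cbilinear_dd_right: "cbilinear (\<lambda>(f :: 'n An) g. f \<otimes>\<^sub>t dd i (g :: 'n An))"
  by (rule cbilinear_comp[OF _ _ cbilinear_tensor]; rule dd_linear clinear_id)+

lemma cbilinear_times: "cbilinear ((*) :: 'a::complex_algebra \<Rightarrow> 'a \<Rightarrow> 'a)"
  by (rule cbilinearI) (simp_all add: distrib_left distrib_right mult_scaleC_left mult_scaleC_right)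

lemma cbilinear_counit_right: "cbilinear (\<lambda>(f :: 'n::finite An) (g :: 'n An). counit g *\<^sub>C f)"
  by (rule cbilinearI)
    (simp_all add: counit_add counit_scaleC scaleC_add_left scaleC_add_right mult.commute
      scaleC_complex_def)

lemma cbilinear_shear: "cbilinear (\<lambda>f g. (f \<otimes>\<^sub>t 1) * translate s g)"
  by (rule cbilinear_comp[OF tensor_clinear_left translate_linear cbilinear_times])

lemmas dd_left_linear = tensor_lift_linear[OF cbilinear_dd_left, folded dd_left_def]
  and dd_right_linear = tensor_lift_linear[OF cbilinear_dd_right, folded dd_right_def]
  and An_mult_linear = tensor_lift_linear[OF cbilinear_times[where ?'a = "'n::finite An"],
      folded An_mult_def]
  and counit_right_linear = tensor_lift_linear[OF cbilinear_counit_right, folded counit_right_def]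
  and shear_linear = tensor_lift_linear[OF cbilinear_shear, folded shear_def]

lemmas An2_add = dd_left_linear[THEN clinear_add] dd_right_linear[THEN clinear_add]
    An_mult_linear[THEN clinear_add] counit_right_linear[THEN clinear_add]
    shear_linear[THEN clinear_add]
  and An2_scaleC = dd_left_linear[THEN clinear_scaleC] dd_right_linear[THEN clinear_scaleC]
    An_mult_linear[THEN clinear_scaleC] counit_right_linear[THEN clinear_scaleC]
    shear_linear[THEN clinear_scaleC]

lemma An2_tensor:
  "dd_left i (f \<otimes>\<^sub>t g) = dd i f \<otimes>\<^sub>t g"
  "dd_right i (f \<otimes>\<^sub>t g) = f \<otimes>\<^sub>t dd i g"
  "An_mult (f \<otimes>\<^sub>t g) = f * g"
  "counit_right (f \<otimes>\<^sub>t g) = counit g *\<^sub>C f"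
  "shear s (f \<otimes>\<^sub>t g) = (f \<otimes>\<^sub>t 1) * translate s g"
  by (simp_all add: dd_left_def dd_right_def An_mult_def counit_right_def shear_def
      tensor_lift_tensor cbilinear_dd_left cbilinear_dd_right cbilinear_times
      cbilinear_counit_right cbilinear_shear)

lemma bilinear_ext:
  fixes B C :: "('a::complex_space, 'b::complex_space) ctensor
    \<Rightarrow> ('c::complex_space, 'd::complex_space) ctensor \<Rightarrow> 'e::complex_space"
  assumes "\<And>v w u. B (v + w) u = B v u + B w u" "\<And>v w u. B v (w + u) = B v w + B v u"
    "\<And>v w u. C (v + w) u = C v u + C w u" "\<And>v w u. C v (w + u) = C v w + C v u"
    and tensor: "\<And>f g h k. B (f \<otimes>\<^sub>t g) (h \<otimes>\<^sub>t k) = C (f \<otimes>\<^sub>t g) (h \<otimes>\<^sub>t k)"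
  shows "B v w = C v w"
proof (induction v rule: ctensor_induct)
  case (tensor f g)
  show ?case
    by (induction w rule: ctensor_induct) (simp_all add: assms)
qed (simp add: assms)

lemma dd_left_mult: "dd_left i (v * w) = v * dd_left i w + w * dd_left i v"
proof (induction v rule: ctensor_induct)
  case (tensor f g)
  show ?case
  proof (induction w rule: ctensor_induct)
    case (tensor h k)
    show ?case
      unfolding tensor_mult An2_tensor dd_mult tensor_add_left by (simp only: mult.commute)
  next
    case (add v w)
    then show ?case
      by (simp only: distrib_left distrib_right An2_add add.assoc add.left_commute)
  qed
next
  case (add v v')
  then show ?case
    by (simp only: distrib_left distrib_right An2_add add.assoc add.left_commute)
qed

lemma dd_right_mult: "dd_right i (v * w) = v * dd_right i w + w * dd_right i v"
proof (induction v rule: ctensor_induct)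
  case (tensor f g)
  show ?case
  proof (induction w rule: ctensor_induct)
    case (tensor h k)
    show ?case
      unfolding tensor_mult An2_tensor dd_mult tensor_add_right by (simp only: mult.commute)
  next
    case (add v w)
    then show ?case
      by (simp only: distrib_left distrib_right An2_add add.assoc add.left_commute)
  qed
next
  case (add v v')
  then show ?case
    by (simp only: distrib_left distrib_right An2_add add.assoc add.left_commute)
qed

lemma An_mult_mult: "An_mult (v * w) = An_mult v * An_mult w"
proof (rule bilinear_ext[where B = "\<lambda>v w. An_mult (v * w)"
      and C = "\<lambda>v w. An_mult v * An_mult w"])
  fix f g h k :: "'a An"
  show "An_mult ((f \<otimes>\<^sub>t g) * (h \<otimes>\<^sub>t k)) = An_mult (f \<otimes>\<^sub>t g) * An_mult (h \<otimes>\<^sub>t k)"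
    unfolding tensor_mult An2_tensor by (simp only: mult.assoc mult.left_commute)
qed (simp_all only: An2_add distrib_left distrib_right)

lemma counit_right_mult: "counit_right (v * w) = counit_right v * counit_right w"
proof (rule bilinear_ext[where B = "\<lambda>v w. counit_right (v * w)"
      and C = "\<lambda>v w. counit_right v * counit_right w"])
  fix f g h k :: "'a An"
  show "counit_right ((f \<otimes>\<^sub>t g) * (h \<otimes>\<^sub>t k))
      = counit_right (f \<otimes>\<^sub>t g) * counit_right (h \<otimes>\<^sub>t k)"
    by (simp add: tensor_mult An2_tensor counit_mult mult_scaleC_left mult_scaleC_right)
qed (simp_all only: An2_add distrib_left distrib_right)

lemma shear_mult: "shear s (v * w) = shear s v * shear s w"
proof (rule bilinear_ext[where B = "\<lambda>v w. shear s (v * w)"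
      and C = "\<lambda>v w. shear s v * shear s w"])
  fix f g h k :: "'a An"
  have "(f * h) \<otimes>\<^sub>t (1 :: 'a An) = (f \<otimes>\<^sub>t 1) * (h \<otimes>\<^sub>t 1)"
    by (simp add: tensor_mult)
  then show "shear s ((f \<otimes>\<^sub>t g) * (h \<otimes>\<^sub>t k)) = shear s (f \<otimes>\<^sub>t g) * shear s (h \<otimes>\<^sub>t k)"
    unfolding tensor_mult[of f g h k] An2_tensor translate_mult
    by (simp add: mult.assoc mult.left_commute)
qed (simp_all add: An2_add distrib_left distrib_right)

text \<open>
  The derivations \<open>d\<^sub>i\<close> are invariant under the translations of \<open>G\<close>. Hence differentiating
  \<open>f(y\<^sup>s z)\<close> in \<open>z\<close>, or in \<open>y\<close>, amounts to differentiating \<open>f\<close> first; in \<open>y\<close> the chain rule adds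
  the factor \<open>s\<close>.
\<close>

lemma dd_right_translate: "dd_right i (translate s f) = translate s (dd i f)"
proof (induction f rule: An_induct_gen)
  case (x j f)
  have "dd_right i (translate_xvar s j) = translate s (dd i (xvar j))"
    by (simp add: translate_xvar_def An2_add An2_scaleC An2_tensor dd_xvar translate_1
        clinear_0[OF translate_linear] one_ctensor_def)
  then show ?case
    by (simp add: translate_mult translate_x dd_right_mult dd_mult translate_add x)
qed (simp_all add: translate_t An2_tensor dd_t tensor_scaleC_right translate_add translate_scaleC
    An2_add An2_scaleC dd_add dd_scaleC)

lemma dd_left_translate: "dd_left i (translate s f) = of_int s *\<^sub>C translate s (dd i f)"
proof (induction f rule: An_induct_gen)
  case (x j f)
  have "dd_left i (translate_xvar s j) = of_int s *\<^sub>C translate s (dd i (xvar j))"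
    by (simp add: translate_xvar_def An2_add An2_scaleC An2_tensor dd_xvar translate_1
        clinear_0[OF translate_linear] one_ctensor_def)
  then show ?case
    by (simp add: translate_mult translate_x dd_left_mult dd_mult translate_add x
        scaleC_add_right mult_scaleC_right)
qed (simp_all add: translate_t An2_tensor dd_t tensor_scaleC_left translate_add translate_scaleC
    An2_add An2_scaleC dd_add dd_scaleC scaleC_add_right mult.commute)

text \<open>
  The next two rules put \<open>z = 1\<close> in \<open>f(y z)\<close> and \<open>z = y\<close> in \<open>f(y\<^sup>-\<^sup>1 z)\<close>.
\<close>

lemma counit_right_translate: "counit_right (translate 1 f) = f"
proof (induction f rule: An_induct_gen)
  case (x j f)
  then show ?case
    by (simp add: translate_mult translate_x counit_right_mult translate_xvar_def An2_add
        An2_scaleC An2_tensor counit_xvar)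
qed (simp_all add: translate_t An2_tensor counit_tx scaleC_one translate_add translate_scaleC
    An2_add An2_scaleC)

lemma An_mult_translate: "An_mult (translate (- 1) f) = counit f *\<^sub>C 1"
proof (induction f rule: An_induct_gen)
  case (t a)
  have "(\<lambda>j. - 1 * a j) + a = 0" by auto
  then have "tx (\<lambda>j. - 1 * a j) 0 * tx a 0 = 1"
    by (simp only: tx_mult tx_0 add_0)
  then show ?case by (simp add: translate_t An2_tensor counit_tx)
next
  case (x j f)
  have "An_mult (translate_xvar (- 1) j) = 0"
    by (simp add: translate_xvar_def An2_tensor clinear_diff[OF An_mult_linear])
  then show ?case
    by (simp add: translate_mult translate_x An_mult_mult counit_xvar counit_mult)
qed (simp_all add: translate_add translate_scaleC An2_add An2_scaleC counit_add counit_scaleC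
    scaleC_add_left scaleC_complex_def)

lemma shear_translate: "shear s (translate s' f) = translate (s + s') f"
proof (induction f rule: An_induct_gen)
  case (t a)
  have "(\<lambda>j. s' * a j) + (\<lambda>j. s * a j) = (\<lambda>j. (s + s') * a j)"
    by (auto simp: distrib_right)
  then have "tx (\<lambda>j. s' * a j) 0 * tx (\<lambda>j. s * a j) 0 = tx (\<lambda>j. (s + s') * a j) 0"
    by (simp only: tx_mult add_0)
  then show ?case by (simp add: translate_t An2_tensor tensor_mult)
next
  case (x j f)
  have "shear s (translate_xvar s' j) = translate_xvar (s + s') j"
    by (simp add: translate_xvar_def An2_add An2_scaleC An2_tensor translate_x translate_1
        scaleC_add_left add.assoc flip: one_ctensor_def)
  then show ?case by (simp add: translate_mult translate_x shear_mult x)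
qed (simp_all add: translate_add translate_scaleC An2_add An2_scaleC)

lemma translate_0: "translate 0 f = 1 \<otimes>\<^sub>t f"
proof (induction f rule: An_induct_gen)
  case (t a)
  have "(\<lambda>j. 0 * a j) = 0" by auto
  then show ?case by (simp only: translate_t tx_0)
qed (simp_all add: translate_mult translate_x translate_xvar_def tensor_mult translate_add
    translate_scaleC tensor_add_right tensor_scaleC_right)

section \<open>Universal properties of enveloping algebras and of the smash product\<close>

definition algebra_hom :: "('a::complex_algebra \<Rightarrow> 'b::complex_algebra) \<Rightarrow> bool"
  where "algebra_hom f \<longleftrightarrow> clinear f \<and> f 1 = 1 \<and> (\<forall>x y. f (x * y) = f x * f y)"

lemma algebra_homD:
  assumes "algebra_hom f"
  shows "clinear f" "f 1 = 1" "f (x * y) = f x * f y" "f (x + y) = f x + f y"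
    "f (c *\<^sub>C x) = c *\<^sub>C f x" "f (x - y) = f x - f y" "f 0 = 0"
  using assms by (auto simp: algebra_hom_def clinear_add clinear_scaleC clinear_diff clinear_0)

definition lie_hom :: "('g::lie_algebra \<Rightarrow> 'a::complex_algebra) \<Rightarrow> bool"
  where "lie_hom f \<longleftrightarrow> clinear f \<and> (\<forall>x y. f (lie x y) = f x * f y - f y * f x)"

text \<open>
  A Lie map \<open>f\<close> into an associative algebra makes that algebra a representation by left
  multiplication; applying \<open>u\<close> to \<open>1\<close> extends \<open>f\<close> to the enveloping algebra.
\<close>

definition uea_lift :: "('g::lie_algebra \<Rightarrow> 'a::complex_algebra) \<Rightarrow> 'g uea \<Rightarrow> 'a"
  where "uea_lift f u = uea_act (\<lambda>x v. f x * v) u 1"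

lemma lie_rep_lie_hom: "lie_hom f \<Longrightarrow> lie_rep (\<lambda>x v. f x * v)"
  unfolding lie_hom_def lie_rep_def
  by (auto intro!: cbilinearI simp: clinear_add clinear_scaleC distrib_left distrib_right
      mult_scaleC_left mult_scaleC_right left_diff_distrib mult.assoc)

lemma uea_lift_of: "lie_hom f \<Longrightarrow> uea_lift f (uea_of x) = f x"
  by (simp add: uea_lift_def uea_act_simps[OF lie_rep_lie_hom])

lemma uea_lift_hom:
  assumes "lie_hom f"
  shows "algebra_hom (uea_lift f)"
proof -
  note act = uea_act_simps[OF lie_rep_lie_hom[OF assms]]
  have "uea_act (\<lambda>x v. f x * v) u v = uea_act (\<lambda>x v. f x * v) u 1 * v" for u v
    by (induction u rule: uea_induct) (simp_all add: act mult.assoc distrib_right mult_scaleC_left)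
  from this[of _ "uea_act (\<lambda>x v. f x * v) _ 1"] show ?thesis
    unfolding algebra_hom_def uea_lift_def by (auto intro!: clinearI simp: act(1,2,5,7))
qed

text \<open>
  Homomorphisms out of the smash product amount to a homomorphism \<open>\<alpha>\<close> on \<open>A\<^sub>n\<close> and a Lie map \<open>\<beta>\<close> on
  \<open>\<gg>\<^sub>n\<close> that satisfy the cross relation.
\<close>

definition smash_lift ::
    "('n::finite An \<Rightarrow> 'a::complex_algebra) \<Rightarrow> ('n gn \<Rightarrow> 'a) \<Rightarrow> 'n smash \<Rightarrow> 'a"
  where "smash_lift \<alpha> \<beta> s = tensor_lift (\<lambda>f u. \<alpha> f * uea_lift \<beta> u) (smash_rep s)"

lemma smash_induct [case_names mult add]:
  fixes s :: "'n::finite smash"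
  assumes mult: "\<And>f u. P (smash_of_A f * smash_of_U u)"
    and add: "\<And>s t. P s \<Longrightarrow> P t \<Longrightarrow> P (s + t)"
  shows "P s"
proof (cases s)
  case (Smash t)
  have "P (Smash t)" for t
  proof (induction t rule: ctensor_induct)
    case (tensor f u)
    show ?case using mult[of f u] by (simp only: smash_of_A_times_U)
  next
    case (add s t)
    then show ?case
      using assms(2)[of "Smash s" "Smash t"] by (simp add: plus_smash.abs_eq eq_onp_def)
  qed
  then show ?thesis by (simp add: Smash)
qed

lemma
  fixes \<alpha> :: "'n::finite An \<Rightarrow> 'a::complex_algebra"
  assumes \<alpha>: "algebra_hom \<alpha>" and \<beta>: "lie_hom \<beta>"
    and comm: "\<And>X f. \<beta> X * \<alpha> f = \<alpha> f * \<beta> X + \<alpha> (vf_apply X f)"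
  shows smash_lift_hom: "algebra_hom (smash_lift \<alpha> \<beta>)"
    and smash_lift_A: "smash_lift \<alpha> \<beta> (smash_of_A f) = \<alpha> f"
    and smash_lift_g: "smash_lift \<alpha> \<beta> (smash_of_g X) = \<beta> X"
proof -
  note \<alpha>D = algebra_homD[OF \<alpha>] and \<beta>D = algebra_homD[OF uea_lift_hom[OF \<beta>]]
  let ?F = "tensor_lift (\<lambda>f u. \<alpha> f * uea_lift \<beta> u)"
  have bil: "cbilinear (\<lambda>f u. \<alpha> f * uea_lift \<beta> u)"
    by (rule cbilinear_comp[OF \<alpha>D(1) \<beta>D(1) cbilinear_times])
  note F = tensor_lift_tensor[OF bil] tensor_lift_add[OF bil] tensor_lift_scaleC[OF bil]
  have act: "?F (smash_act X t) = \<beta> X * ?F t" for X t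
  proof (induction t rule: ctensor_induct)
    case (tensor f u)
    have "?F (smash_act X (f \<otimes>\<^sub>t u)) = (\<alpha> f * \<beta> X + \<alpha> (vf_apply X f)) * uea_lift \<beta> u"
      by (simp add: smash_act_tensor F \<beta>D uea_lift_of[OF \<beta>] distrib_right mult.assoc)
    then show ?case
      unfolding comm[symmetric] by (simp add: F mult.assoc)
  qed (simp add: smash_act_add F distrib_left)
  have uact: "?F (uea_act smash_act u t) = uea_lift \<beta> u * ?F t" for u t
    by (induction u rule: uea_induct)
      (simp_all add: smash_uea_act F act \<beta>D uea_lift_of[OF \<beta>] mult.assoc distrib_right
        mult_scaleC_left)
  have left: "?F ((f \<otimes>\<^sub>t 1) * t) = \<alpha> f * ?F t" for f t
    by (induction t rule: ctensor_induct)
      (simp_all add: tensor_mult F \<alpha>D mult.assoc distrib_left)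
  have times: "?F (smash_times s t) = ?F s * ?F t" for s t
    by (induction s rule: ctensor_induct)
      (simp_all add: smash_times_tensor smash_times_simps F left uact mult.assoc distrib_right)
  show "algebra_hom (smash_lift \<alpha> \<beta>)"
    unfolding algebra_hom_def smash_lift_def
    by (auto intro!: clinearI simp: plus_smash.rep_eq scaleC_smash.rep_eq times_smash.rep_eq
        one_smash.rep_eq F times \<alpha>D \<beta>D)
  show "smash_lift \<alpha> \<beta> (smash_of_A f) = \<alpha> f"
    by (simp add: smash_lift_def smash_of_A_def Smash_inverse F \<beta>D)
  show "smash_lift \<alpha> \<beta> (smash_of_g X) = \<beta> X"
    by (simp add: smash_lift_def smash_of_U_def Smash_inverse F \<alpha>D uea_lift_of[OF \<beta>])
qed

lemma gn_sum: "X = (\<Sum>i\<in>UNIV. vf (coeff X i) i)"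
proof -
  have "coeff (sum f S) j = (\<Sum>i\<in>S. coeff (f i) j)" for f :: "'a \<Rightarrow> 'a gn" and S j
    by (induction S rule: infinite_finite_induct) (simp_all add: coeff_simps)
  then show ?thesis
    by (auto simp: coeff_inject[symmetric] fun_eq_iff coeff_vf)
qed

lemma sum_induct:
  assumes "P 0" "\<And>i. P (f i)" "\<And>x y. P x \<Longrightarrow> P y \<Longrightarrow> P (x + y)"
  shows "P (sum f S)"
  by (induction S rule: infinite_finite_induct) (simp_all add: assms)

lemma gn_induct [case_names vf add]:
  fixes X :: "'n::finite gn"
  assumes vf: "\<And>f i. P (vf f i)" and add: "\<And>X Y. P X \<Longrightarrow> P Y \<Longrightarrow> P (X + Y)"
  shows "P X"
proof -
  have "P 0" using vf[of 0] by (simp add: vf_def zero_gn_def)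
  then show ?thesis by (subst gn_sum) (rule sum_induct[OF _ vf add])
qed

lemma smash_of_A_hom: "algebra_hom smash_of_A"
  unfolding algebra_hom_def
  by (auto intro!: clinearI simp: smash_of_A_1 smash_of_A_mult)
    (simp_all add: smash_of_A_def tensor_add_left tensor_scaleC_left plus_smash.abs_eq
      scaleC_smash.abs_eq eq_onp_def)

lemma smash_of_U_hom: "algebra_hom smash_of_U"
  unfolding algebra_hom_def
  by (auto intro!: clinearI simp: smash_of_U_1 smash_of_U_mult)
    (simp_all add: smash_of_U_def tensor_add_right tensor_scaleC_right plus_smash.abs_eq
      scaleC_smash.abs_eq eq_onp_def)

lemma smash_hom_eqI:
  fixes F G :: "'n::finite smash \<Rightarrow> 'a::complex_algebra"
  assumes F: "algebra_hom F" and G: "algebra_hom G"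
    and A: "\<And>f. F (smash_of_A f) = G (smash_of_A f)"
    and g: "\<And>f i. F (smash_of_g (vf f i)) = G (smash_of_g (vf f i))"
  shows "F s = G s"
proof -
  note FG = algebra_homD[OF F] algebra_homD[OF G] algebra_homD[OF smash_of_U_hom]
  have "F (smash_of_g X) = G (smash_of_g X)" for X
    by (induction X rule: gn_induct) (simp_all add: g uea_of_simps FG)
  then have "F (smash_of_U u) = G (smash_of_U u)" for u
    by (induction u rule: uea_induct) (simp_all add: FG)
  then show ?thesis
    by (induction s rule: smash_induct) (simp_all add: A FG)
qed

section \<open>Computing in the smash product and in \<open>D\<^sub>n\<close>\<close>

lemma vf_add: "vf (f + g) i = vf f i + vf g i"
  and vf_diff: "vf (f - g) i = vf f i - vf g i"
  and vf_scaleC: "vf (c *\<^sub>C f) i = c *\<^sub>C vf f i"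
  by (auto simp: coeff_inject[symmetric] fun_eq_iff coeff_simps coeff_vf)

lemma vf_linear: "clinear (\<lambda>f. vf f i)"
  by (rule clinearI) (rule vf_add vf_scaleC)+

lemmas vf_0 = clinear_0[OF vf_linear]

lemma uea_of_linear: "clinear uea_of"
  by (rule clinearI) (rule uea_of_simps)+

lemma smash_of_g_linear: "clinear smash_of_g"
  by (rule clinearI)
    (simp_all add: uea_of_simps algebra_homD[OF smash_of_U_hom])

lemma smash_of_g_lie:
  "smash_of_g (lie X Y) = smash_of_g X * smash_of_g Y - smash_of_g Y * smash_of_g X"
  by (simp add: uea_of_simps algebra_homD[OF smash_of_U_hom])

lemma Dn_rep_hom: "algebra_hom Dn_rep"
  unfolding algebra_hom_def
  by (auto intro!: clinearI simp: one_Dn.rep_eq plus_Dn.rep_eq times_Dn.rep_eq scaleC_Dn.rep_eq)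

lemma Dn_rep_of_A [simp]: "Dn_rep (Dn_of_A f) = smash_of_A f"
  by (simp add: Dn_of_A_def Dn_abs_inverse)

lemma Dn_rep_d [simp]: "Dn_rep (Dn_d i) = smash_of_g (vf 1 i)"
  by (simp add: Dn_d_def Dn_abs_inverse)

lemma Dn_of_A_hom: "algebra_hom Dn_of_A"
  unfolding algebra_hom_def
  by (auto intro!: clinearI
      simp: Dn_rep_inject[symmetric] algebra_homD[OF Dn_rep_hom] algebra_homD[OF smash_of_A_hom])

lemma Dn_d_of_A: "Dn_d i * Dn_of_A f = Dn_of_A f * Dn_d i + Dn_of_A (dd i f)"
  by (simp add: Dn_rep_inject[symmetric] algebra_homD[OF Dn_rep_hom] smash_relation vf_apply_vf)

lemma Dn_d_commute: "Dn_d i * Dn_d j = Dn_d j * Dn_d i"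
proof -
  have "lie (vf 1 i) (vf 1 j) = (0 :: 'a gn)"
    by (simp add: lie_vf_vf vf_0)
  then have "smash_of_g (vf 1 i) * smash_of_g (vf 1 j) - smash_of_g (vf 1 j) * smash_of_g (vf 1 i)
      = (0 :: 'a smash)"
    by (metis smash_of_g_lie clinear_0[OF smash_of_g_linear])
  then show ?thesis
    by (simp add: Dn_rep_inject[symmetric] algebra_homD[OF Dn_rep_hom])
qed

lemma Dn_induct [case_names A d one add mult scale]:
  fixes d :: "'n::finite Dn"
  assumes "\<And>f. P (Dn_of_A f)" "\<And>i. P (Dn_d i)" "P 1"
    "\<And>x y. P x \<Longrightarrow> P y \<Longrightarrow> P (x + y)" "\<And>x y. P x \<Longrightarrow> P y \<Longrightarrow> P (x * y)" "\<And>c x. P x \<Longrightarrow> P (c *\<^sub>C x)"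
  shows "P d"
proof -
  note rep = algebra_homD(2-5)[OF Dn_rep_hom, symmetric]
  let ?B = "Dn_rep ` {x. P x}"
  have "subalgebra ?B"
    unfolding subalgebra_def by (auto simp: rep assms(3-6) intro!: imageI)
  moreover have "range smash_of_A \<union> range (\<lambda>i. smash_of_g (vf 1 i)) \<subseteq> ?B"
    using assms(1,2) by (auto simp flip: Dn_rep_of_A Dn_rep_d)
  ultimately have "Dn_set \<subseteq> ?B"
    unfolding Dn_set_def by (intro hull_minimal)
  then show ?thesis using Dn_rep[of d] by (auto simp: Dn_rep_inject)
qed

section \<open>The Lie algebra \<open>\<mm>\<^sub>1\<^sub>,\<^sub>0\<Delta>\<close>\<close>

lemma counit_m10: "h \<in> m10 \<Longrightarrow> counit h = 0"
  unfolding m10_def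
proof (induction rule: An_module.span_induct_alt)
  case (step c x y)
  from step(1) have "counit x = 0"
    by (auto simp: counit_diff counit_xvar tvar_def counit_tx)
  then show ?case using step by (simp add: counit_add counit_mult)
qed (simp add: counit_0)

lemma reduced_m10: "g - counit g *\<^sub>C 1 \<in> m10"
proof (induction g rule: An_induct)
  case (tx a m)
  then show ?case using tx_m10[of a m] by (simp add: counit_tx scaleC_one split: if_splits)
next
  case (add p q)
  have "p + q - counit (p + q) *\<^sub>C 1 = (p - counit p *\<^sub>C 1) + (q - counit q *\<^sub>C 1)"
    by (simp add: counit_add scaleC_add_left)
  then show ?case using add by (simp only: m10_closed)
next
  case (scale c p)
  have "c *\<^sub>C p - counit (c *\<^sub>C p) *\<^sub>C 1 = c *\<^sub>C (p - counit p *\<^sub>C 1)"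
    by (simp add: counit_scaleC cvs.scale_right_diff_distrib scaleC_complex_def)
  then show ?case using scale by (simp only: m10_closed)
qed

text \<open>
  Subtracting the value at the neutral element makes the projection of \<open>\<gg>\<^sub>n\<close> onto
  \<open>\<mm>\<^sub>1\<^sub>,\<^sub>0\<Delta>\<close> along \<open>\<Delta>\<close> a total function of \<open>g\<close>. The term \<open>t\<^sup>a x\<^sup>r d\<^sub>i - \<delta>\<^sub>r\<^sub>,\<^sub>0 d\<^sub>i\<close> of the formula for the
  isomorphism is the value at \<open>g = t\<^sup>a x\<^sup>r\<close>.
\<close>

definition reduced :: "'n::finite \<Rightarrow> 'n An \<Rightarrow> 'n mDelta"
  where "reduced i g = mDelta_abs (vf (g - counit g *\<^sub>C 1) i)"

lemma rep_reduced: "mDelta_rep (reduced i g) = vf (g - counit g *\<^sub>C 1) i"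
  unfolding reduced_def
  by (rule mDelta_abs_inverse) (simp add: coeff_vf reduced_m10 m10_closed)

lemma reduced_linear: "clinear (reduced i)"
  by (rule clinearI)
    (auto simp: mDelta_rep_inject[symmetric] rep_reduced plus_mDelta.rep_eq scaleC_mDelta.rep_eq
      counit_add counit_scaleC scaleC_add_left scaleC_complex_def cvs.scale_right_diff_distrib
      add_diff_add simp flip: vf_add vf_scaleC)

lemmas reduced_scaleC = clinear_scaleC[OF reduced_linear]
  and reduced_diff = clinear_diff[OF reduced_linear]

lemma reduced_1: "reduced i 1 = 0"
  by (simp add: mDelta_rep_inject[symmetric] rep_reduced zero_mDelta.rep_eq scaleC_one
      vf_0)

lemma reduced_tx:
  "reduced i (tx a r) = mDelta_abs (vf (tx a r) i - (if r = 0 then vf 1 i else 0))"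
  by (auto simp: reduced_def counit_tx scaleC_one vf_diff vf_0)

text \<open>
  The correction terms come from expanding \<open>(f - \<epsilon>(f)) d\<^sub>i(g)\<close>, which already vanishes at the
  neutral element.
\<close>

lemma lie_reduced:
  "lie (reduced i f) (reduced j g) = reduced j (f * dd i g) - counit f *\<^sub>C reduced j (dd i g)
    - (reduced i (g * dd j f) - counit g *\<^sub>C reduced i (dd j f))"
proof -
  have eq: "reduced j (f * dd i g) - counit f *\<^sub>C reduced j (dd i g)
      = reduced j ((f - counit f *\<^sub>C 1) * dd i g)" for i j and f g :: "'a An"
    by (simp add: left_diff_distrib mult_scaleC_left reduced_diff reduced_scaleC)
  have "mDelta_rep (reduced j ((f - counit f *\<^sub>C 1) * dd i g))
      = vf ((f - counit f *\<^sub>C 1) * dd i g) j" for i j and f g :: "'a An"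
    by (simp add: rep_reduced counit_mult counit_diff counit_scaleC scaleC_complex_def)
  then show ?thesis
    unfolding eq
    by (simp add: mDelta_rep_inject[symmetric] lie_mDelta.rep_eq minus_mDelta.rep_eq rep_reduced
        lie_vf_vf dd_diff dd_scaleC)
qed

lemma mDelta_induct [case_names reduced add]:
  fixes Y :: "'n::finite mDelta"
  assumes reduced: "\<And>i h. counit h = 0 \<Longrightarrow> P (reduced i h)" and add: "\<And>X Y. P X \<Longrightarrow> P Y \<Longrightarrow> P (X + Y)"
  shows "P Y"
proof -
  let ?c = "coeff (mDelta_rep Y)"
  have 0: "counit (?c i) = 0" for i
    using mDelta_rep[of Y] by (simp add: counit_m10)
  have "mDelta_rep (sum f S) = (\<Sum>i\<in>S. mDelta_rep (f i))" for f :: "'n \<Rightarrow> 'n mDelta" and S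
    by (induction S rule: infinite_finite_induct) (simp_all add: zero_mDelta.rep_eq plus_mDelta.rep_eq)
  then have "Y = (\<Sum>i\<in>UNIV. reduced i (?c i))"
    using gn_sum[of "mDelta_rep Y"]
    by (simp add: mDelta_rep_inject[symmetric] rep_reduced 0)
  moreover have "P 0"
    using reduced[of 0] by (simp add: counit_0 clinear_0[OF reduced_linear])
  then have "P (\<Sum>i\<in>UNIV. reduced i (?c i))"
    by (rule sum_induct) (simp_all add: add reduced 0)
  ultimately show ?thesis by simp
qed

section \<open>The homomorphism into \<open>D\<^sub>n \<otimes> U(\<mm>\<^sub>1\<^sub>,\<^sub>0\<Delta>)\<close>\<close>

text \<open>
  The part of the isomorphism with a nontrivial component in \<open>U(\<mm>\<^sub>1\<^sub>,\<^sub>0\<Delta>)\<close>: it sends \<open>f d\<^sub>i\<close> to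
  \<open>phi_red i (translate 1 f)\<close>, up to a summand in \<open>D\<^sub>n \<otimes> 1\<close>. Keeping a free argument in
  \<open>A\<^sub>n \<otimes> A\<^sub>n\<close> allows the commutators to be computed on pure tensors.
\<close>

definition phi_red :: "'n::finite \<Rightarrow> 'n An2 \<Rightarrow> ('n Dn, 'n mDelta uea) ctensor"
  where "phi_red i = tensor_lift (\<lambda>f g. Dn_of_A f \<otimes>\<^sub>t uea_of (reduced i g))"

lemma clinear_comp: "clinear f \<Longrightarrow> clinear g \<Longrightarrow> clinear (\<lambda>x. f (g x))"
  by (rule clinearI) (simp_all add: clinear_add clinear_scaleC)

lemma cbilinear_phi_red: "cbilinear (\<lambda>(f :: 'n::finite An) (g :: 'n An). Dn_of_A f \<otimes>\<^sub>t uea_of (reduced i g))"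
  by (rule cbilinear_comp[OF algebra_homD(1)[OF Dn_of_A_hom]
        clinear_comp[OF uea_of_linear reduced_linear] cbilinear_tensor])

lemmas phi_red_linear = tensor_lift_linear[OF cbilinear_phi_red, folded phi_red_def]
  and phi_red_tensor = tensor_lift_tensor[OF cbilinear_phi_red, folded phi_red_def]

lemmas phi_red_add = clinear_add[OF phi_red_linear]
  and phi_red_scaleC = clinear_scaleC[OF phi_red_linear]

lemmas A_simps = algebra_homD[OF Dn_of_A_hom]

lemma phi_red_left_mult: "phi_red i ((f \<otimes>\<^sub>t 1) * v) = (Dn_of_A f \<otimes>\<^sub>t 1) * phi_red i v"
  by (induction v rule: ctensor_induct)
    (simp_all add: tensor_mult phi_red_tensor phi_red_add distrib_left A_simps)

lemma phi_red_commutes_A: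
  "phi_red i v * (Dn_of_A f \<otimes>\<^sub>t 1) = (Dn_of_A f \<otimes>\<^sub>t 1) * phi_red i v"
proof (induction v rule: ctensor_induct)
  case (tensor g h)
  have "Dn_of_A g * Dn_of_A f = Dn_of_A f * Dn_of_A g"
    by (simp only: A_simps(3)[symmetric] mult.commute[of g f])
  then show ?case by (simp add: phi_red_tensor tensor_mult)
qed (simp add: phi_red_add distrib_left distrib_right)

text \<open>
  The terms with \<open>counit_right\<close> are the failure of \<open>phi_red\<close> to be a Lie map. They are cancelled
  by the commutators with the summand in \<open>D\<^sub>n \<otimes> 1\<close>, see \<open>d_phi_red\<close>.
\<close>

lemma phi_red_lie:
  "phi_red i v * phi_red j w - phi_red j w * phi_red i v
    = phi_red j (v * dd_right i w) - phi_red j ((counit_right v \<otimes>\<^sub>t 1) * dd_right i w)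
    - (phi_red i (w * dd_right j v) - phi_red i ((counit_right w \<otimes>\<^sub>t 1) * dd_right j v))"
    (is "?L v w = ?R v w")
proof (rule bilinear_ext[where B = ?L and C = ?R])
  fix f g h k :: "'a An"
  have "?L (f \<otimes>\<^sub>t g) (h \<otimes>\<^sub>t k) = Dn_of_A (f * h) \<otimes>\<^sub>t uea_of (lie (reduced i g) (reduced j k))"
    by (simp add: phi_red_tensor tensor_mult uea_of_simps tensor_diff_right mult.commute[of h f]
        flip: A_simps(3))
  also have "\<dots> = ?R (f \<otimes>\<^sub>t g) (h \<otimes>\<^sub>t k)"
    by (simp add: lie_reduced An2_tensor phi_red_tensor tensor_mult clinear_diff[OF uea_of_linear]
        uea_of_simps tensor_diff_right tensor_scaleC_left tensor_scaleC_right mult_scaleC_left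
        phi_red_scaleC mult.commute[of h f])
  finally show "?L (f \<otimes>\<^sub>t g) (h \<otimes>\<^sub>t k) = ?R (f \<otimes>\<^sub>t g) (h \<otimes>\<^sub>t k)" .
qed (simp_all only: distrib_left distrib_right phi_red_add An2_add tensor_add_left add_diff_add)

lemma Dn_lie:
  "(Dn_of_A f * Dn_d i) * (Dn_of_A g * Dn_d j) - (Dn_of_A g * Dn_d j) * (Dn_of_A f * Dn_d i)
    = Dn_of_A (f * dd i g) * Dn_d j - Dn_of_A (g * dd j f) * Dn_d i"
proof -
  have *: "(Dn_of_A f * Dn_d i) * (Dn_of_A g * Dn_d j)
      = Dn_of_A (f * g) * (Dn_d i * Dn_d j) + Dn_of_A (f * dd i g) * Dn_d j" for f g :: "'a An" and i j
  proof -
    have "(Dn_of_A f * Dn_d i) * (Dn_of_A g * Dn_d j) = Dn_of_A f * (Dn_d i * Dn_of_A g) * Dn_d j"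
      by (simp only: mult.assoc)
    then show ?thesis
      by (simp add: Dn_d_of_A distrib_left distrib_right A_simps mult.assoc)
  qed
  show ?thesis
    unfolding * by (simp add: mult.commute[of g f] Dn_d_commute[of j i])
qed

lemma d_phi_red:
  "((Dn_of_A f * Dn_d i) \<otimes>\<^sub>t 1) * phi_red j w - phi_red j w * ((Dn_of_A f * Dn_d i) \<otimes>\<^sub>t 1)
    = phi_red j ((f \<otimes>\<^sub>t 1) * dd_left i w)"
proof (induction w rule: ctensor_induct)
  case (tensor g h)
  have "Dn_of_A f * Dn_d i * Dn_of_A g = Dn_of_A g * (Dn_of_A f * Dn_d i) + Dn_of_A (f * dd i g)"
    by (simp add: mult.assoc Dn_d_of_A distrib_left mult.commute[of f g] A_simps(3)[symmetric]
        flip: mult.assoc[of _ _ "Dn_d i"])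
  then show ?case
    by (simp add: phi_red_tensor tensor_mult An2_tensor tensor_add_left)
qed (simp add: phi_red_add distrib_left distrib_right An2_add algebra_simps)

definition phi_g :: "'n::finite gn \<Rightarrow> ('n Dn, 'n mDelta uea) ctensor"
  where "phi_g X = (\<Sum>i\<in>UNIV.
    phi_red i (translate 1 (coeff X i)) + (Dn_of_A (coeff X i) * Dn_d i) \<otimes>\<^sub>t 1)"

lemma phi_g_linear: "clinear phi_g"
  by (rule clinearI)
    (simp_all add: phi_g_def coeff_simps translate_add translate_scaleC phi_red_add phi_red_scaleC
      A_simps distrib_right mult_scaleC_left tensor_add_left tensor_scaleC_left sum.distrib
      scaleC_add_right cvs.scale_sum_right)

lemma phi_g_vf: "phi_g (vf f i) = phi_red i (translate 1 f) + (Dn_of_A f * Dn_d i) \<otimes>\<^sub>t 1"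
proof -
  have "phi_g (vf f i) = (\<Sum>j\<in>UNIV. if j = i
      then phi_red i (translate 1 f) + (Dn_of_A f * Dn_d i) \<otimes>\<^sub>t 1 else 0)"
    unfolding phi_g_def
    by (rule sum.cong)
      (auto simp: coeff_vf clinear_0[OF translate_linear] clinear_0[OF phi_red_linear] A_simps)
  then show ?thesis by simp
qed

lemma phi_g_d: "phi_g (vf 1 i) = Dn_d i \<otimes>\<^sub>t 1"
  by (simp add: phi_g_vf translate_1 one_ctensor_def phi_red_tensor reduced_1
      clinear_0[OF uea_of_linear] A_simps)

text \<open>
  For \<open>v = translate 1 f\<close> and \<open>w = translate 1 g\<close> the correction term in \<open>phi_red_lie\<close> is
  \<open>(f \<otimes> 1) * dd_right i w\<close>, and the commutator with \<open>f d\<^sub>i\<close> contributes \<open>(f \<otimes> 1) * dd_left i w\<close>. The two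
  agree by invariance of \<open>d\<^sub>i\<close>.
\<close>

lemma phi_g_lie: "phi_g (lie X Y) = phi_g X * phi_g Y - phi_g Y * phi_g X"
proof (induction X rule: gn_induct)
  case (vf f i)
  show ?case
  proof (induction Y rule: gn_induct)
    case (vf g j)
    let ?X = "phi_red i (translate 1 f)" and ?Y = "phi_red j (translate 1 g)"
      and ?D = "\<lambda>f i. (Dn_of_A f * Dn_d i) \<otimes>\<^sub>t (1 :: 'a mDelta uea)"
    have "(?X * ?Y - ?Y * ?X) + (?D f i * ?Y - ?Y * ?D f i) - (?D g j * ?X - ?X * ?D g j)
        = phi_red j (translate 1 (f * dd i g)) - phi_red i (translate 1 (g * dd j f))"
      unfolding phi_red_lie d_phi_red dd_right_translate dd_left_translate counit_right_translate
      by (simp add: translate_mult scaleC_one)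
    moreover have "?D f i * ?D g j - ?D g j * ?D f i = ?D (f * dd i g) j - ?D (g * dd j f) i"
      by (simp add: tensor_mult Dn_lie flip: tensor_diff_left)
    ultimately show ?case
      by (simp add: lie_vf_vf clinear_diff[OF phi_g_linear] phi_g_vf algebra_simps)
  qed (simp add: lie_add_right clinear_add[OF phi_g_linear] algebra_simps)
qed (simp add: lie_add_left clinear_add[OF phi_g_linear] algebra_simps)

lemma phi_g_lie_hom: "lie_hom phi_g"
  by (simp add: lie_hom_def phi_g_linear phi_g_lie)

lemma tensor_left_hom:
  assumes "algebra_hom f"
  shows "algebra_hom (\<lambda>x. f x \<otimes>\<^sub>t 1)"
  unfolding algebra_hom_def
  by (auto intro!: clinearI simp: algebra_homD[OF assms] tensor_add_left tensor_scaleC_left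
      tensor_mult one_ctensor_def)

lemma phi_g_relation:
  "phi_g X * (Dn_of_A f \<otimes>\<^sub>t 1) = (Dn_of_A f \<otimes>\<^sub>t 1) * phi_g X + Dn_of_A (vf_apply X f) \<otimes>\<^sub>t 1"
proof (induction X rule: gn_induct)
  case (vf g i)
  have "Dn_of_A g * Dn_d i * Dn_of_A f = Dn_of_A f * (Dn_of_A g * Dn_d i) + Dn_of_A (g * dd i f)"
    by (simp add: mult.assoc Dn_d_of_A distrib_left mult.commute[of f g] A_simps(3)[symmetric]
        flip: mult.assoc[of _ _ "Dn_d i"])
  then show ?case
    by (simp add: phi_g_vf distrib_left distrib_right phi_red_commutes_A tensor_mult vf_apply_vf
        tensor_add_left)
qed (simp add: clinear_add[OF phi_g_linear] distrib_left distrib_right vf_apply_simps A_simps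
    tensor_add_left)

definition phi :: "'n::finite smash \<Rightarrow> ('n Dn, 'n mDelta uea) ctensor"
  where "phi = smash_lift (\<lambda>f. Dn_of_A f \<otimes>\<^sub>t 1) phi_g"

lemmas phi_props = smash_lift_hom[OF tensor_left_hom[OF Dn_of_A_hom] phi_g_lie_hom phi_g_relation]
    smash_lift_A[OF tensor_left_hom[OF Dn_of_A_hom] phi_g_lie_hom phi_g_relation]
    smash_lift_g[OF tensor_left_hom[OF Dn_of_A_hom] phi_g_lie_hom phi_g_relation]

lemma phi_hom: "algebra_hom phi"
  and phi_A: "phi (smash_of_A f) = Dn_of_A f \<otimes>\<^sub>t 1"
  and phi_of_g: "phi (smash_of_g X) = phi_g X"
  unfolding phi_def by (fact phi_props)+

lemma phi_Dn: "phi (Dn_rep d) = d \<otimes>\<^sub>t 1"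
  by (induction d rule: Dn_induct)
    (simp_all add: algebra_homD[OF phi_hom] algebra_homD[OF Dn_rep_hom] phi_A phi_of_g phi_g_d
      one_ctensor_def tensor_mult tensor_add_left tensor_scaleC_left)

section \<open>The inverse homomorphism\<close>

lemmas S_simps = algebra_homD[OF smash_of_A_hom]

lemma smash_relation_vf:
  "smash_of_g (vf g i) * smash_of_A f = smash_of_A f * smash_of_g (vf g i) + smash_of_A (g * dd i f)"
  by (simp add: smash_relation vf_apply_vf)

text \<open>
  The element \<open>f \<cdot> (g d\<^sub>i)\<close> of the smash product, linear in \<open>f \<otimes> g\<close>. As for \<open>phi_red\<close>, commutators are
  computed for arbitrary tensors first.
\<close>

definition smash_vf :: "'n::finite \<Rightarrow> 'n An2 \<Rightarrow> 'n smash"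
  where "smash_vf i = tensor_lift (\<lambda>f g. smash_of_A f * smash_of_g (vf g i))"

lemma cbilinear_smash_vf:
  "cbilinear (\<lambda>(f :: 'n::finite An) (g :: 'n An). smash_of_A f * smash_of_g (vf g i))"
  by (rule cbilinear_comp[OF algebra_homD(1)[OF smash_of_A_hom]
        clinear_comp[OF smash_of_g_linear vf_linear] cbilinear_times])

lemmas smash_vf_linear = tensor_lift_linear[OF cbilinear_smash_vf, folded smash_vf_def]
  and smash_vf_tensor = tensor_lift_tensor[OF cbilinear_smash_vf, folded smash_vf_def]

lemmas smash_vf_add = clinear_add[OF smash_vf_linear]
  and smash_vf_scaleC = clinear_scaleC[OF smash_vf_linear]
  and smash_vf_diff = clinear_diff[OF smash_vf_linear]

lemma smash_vf_left_mult: "smash_vf i ((f \<otimes>\<^sub>t 1) * v) = smash_of_A f * smash_vf i v"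
  by (induction v rule: ctensor_induct)
    (simp_all add: tensor_mult smash_vf_tensor smash_vf_add distrib_left S_simps mult.assoc)

lemma smash_vf_A:
  "smash_vf i v * smash_of_A f = smash_of_A f * smash_vf i v + smash_of_A (An_mult v * dd i f)"
proof (induction v rule: ctensor_induct)
  case (tensor g h)
  have comm: "smash_of_A g * smash_of_A f = smash_of_A f * smash_of_A g"
    by (simp only: S_simps(3)[symmetric] mult.commute[of g f])
  have "smash_of_A g * smash_of_g (vf h i) * smash_of_A f
      = (smash_of_A g * smash_of_A f) * smash_of_g (vf h i) + smash_of_A g * smash_of_A (h * dd i f)"
    by (simp only: mult.assoc smash_relation_vf distrib_left)
  then show ?case
    unfolding comm smash_vf_tensor An2_tensor by (simp only: S_simps(3) mult.assoc)
next
  case (add v w)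
  then show ?case
    by (simp only: smash_vf_add An2_add distrib_left distrib_right S_simps(4) add.assoc
        add.left_commute)
qed

lemma d_smash_vf:
  "smash_of_g (vf 1 j) * smash_vf i v
    = smash_vf i v * smash_of_g (vf 1 j) + smash_vf i (dd_left j v + dd_right j v)"
proof (induction v rule: ctensor_induct)
  case (tensor g h)
  let ?d = "smash_of_g (vf 1 j)" and ?X = "\<lambda>h. smash_of_g (vf h i)"
  have "?d * ?X h - ?X h * ?d = ?X (dd j h)"
    by (simp add: lie_vf_vf vf_0 flip: smash_of_g_lie)
  then have X: "?d * ?X h = ?X h * ?d + ?X (dd j h)"
    by (simp add: algebra_simps)
  have "?d * (smash_of_A g * ?X h) = (?d * smash_of_A g) * ?X h"
    by (simp only: mult.assoc)
  also have "\<dots> = smash_of_A g * (?d * ?X h) + smash_of_A (dd j g) * ?X h"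
    by (simp add: smash_relation_vf distrib_right mult.assoc)
  finally show ?case
    by (simp add: X smash_vf_tensor An2_tensor smash_vf_add distrib_left mult.assoc
        add.assoc add.commute)
qed (simp add: smash_vf_add An2_add distrib_left distrib_right add.assoc add.left_commute)

text \<open>
  The last bracket vanishes for the tensors used below: for \<open>h\<close> in \<open>m10\<close> the function
  \<open>h(y\<^sup>-\<^sup>1 z)\<close> is zero on the diagonal.
\<close>

lemma smash_vf_lie:
  "smash_vf i v * smash_vf j w - smash_vf j w * smash_vf i v
    = (smash_vf j (v * dd_right i w) - smash_vf i (w * dd_right j v))
    + (smash_vf j ((An_mult v \<otimes>\<^sub>t 1) * dd_left i w)
      - smash_vf i ((An_mult w \<otimes>\<^sub>t 1) * dd_left j v))"
    (is "?L v w = ?R v w")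
proof (rule bilinear_ext[where B = ?L and C = ?R])
  fix f g h k :: "'a An"
  let ?A = "smash_of_A :: 'a An \<Rightarrow> _" and ?X = "\<lambda>g i. smash_of_g (vf (g :: 'a An) i)"
  have *: "(?A f * ?X g i) * (?A h * ?X k j)
      = ?A (f * h) * (?X g i * ?X k j) + ?A (f * g * dd i h) * ?X k j" for f g h k i j
  proof -
    have "(?A f * ?X g i) * (?A h * ?X k j) = ?A f * (?X g i * ?A h) * ?X k j"
      by (simp only: mult.assoc)
    then show ?thesis
      by (simp only: smash_relation_vf distrib_left distrib_right S_simps(3) mult.assoc)
  qed
  have "?L (f \<otimes>\<^sub>t g) (h \<otimes>\<^sub>t k) = ?A (f * h) * smash_of_g (lie (vf g i) (vf k j))
      + (?A (f * g * dd i h) * ?X k j - ?A (h * k * dd j f) * ?X g i)"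
    by (simp only: smash_vf_tensor * smash_of_g_lie right_diff_distrib mult.commute[of h f]
        add_diff_add)
  also have "\<dots> = ?R (f \<otimes>\<^sub>t g) (h \<otimes>\<^sub>t k)"
    by (simp only: lie_vf_vf An2_tensor smash_vf_tensor tensor_mult mult_1
        clinear_diff[OF vf_linear] clinear_diff[OF smash_of_g_linear] right_diff_distrib
        mult.commute[of h f])
  finally show "?L (f \<otimes>\<^sub>t g) (h \<otimes>\<^sub>t k) = ?R (f \<otimes>\<^sub>t g) (h \<otimes>\<^sub>t k)" .
qed (simp_all only: distrib_left distrib_right smash_vf_add An2_add tensor_add_left add_diff_add
    add.assoc add.left_commute add.commute)

text \<open>
  \<open>theta\<close> maps \<open>\<mm>\<^sub>1\<^sub>,\<^sub>0\<Delta>\<close> to the centralizer of \<open>D\<^sub>n\<close>. Read \<open>h(y\<^sup>-\<^sup>1 z) d\<^sub>i\<close> as the vector field \<open>h d\<^sub>i\<close>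
  moved so that it vanishes at \<open>y\<close> instead of at the neutral element, and then let \<open>y\<close> be the
  coordinates of the factor \<open>A\<^sub>n\<close>.
\<close>

definition theta :: "'n::finite mDelta \<Rightarrow> 'n smash"
  where "theta Y = (\<Sum>i\<in>UNIV. smash_vf i (translate (- 1) (coeff (mDelta_rep Y) i)))"

lemma theta_linear: "clinear theta"
  by (rule clinearI)
    (simp_all add: theta_def plus_mDelta.rep_eq scaleC_mDelta.rep_eq coeff_simps translate_add
      translate_scaleC smash_vf_add smash_vf_scaleC sum.distrib cvs.scale_sum_right)

lemma theta_reduced:
  "theta (reduced i g) = smash_vf i (translate (- 1) g) - counit g *\<^sub>C smash_of_g (vf 1 i)"
proof -
  have "theta (reduced i g) = (\<Sum>j\<in>UNIV. if j = i
      then smash_vf i (translate (- 1) (g - counit g *\<^sub>C 1)) else 0)"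
    unfolding theta_def
    by (rule sum.cong)
      (auto simp: rep_reduced coeff_vf clinear_0[OF translate_linear] clinear_0[OF smash_vf_linear])
  also have "\<dots> = smash_vf i (translate (- 1) g) - counit g *\<^sub>C smash_vf i 1"
    by (simp add: translate_diff translate_scaleC smash_vf_diff smash_vf_scaleC translate_1)
  finally show ?thesis
    by (simp add: one_ctensor_def smash_vf_tensor S_simps)
qed

text \<open>
  The commutator with \<open>A\<^sub>n\<close> is given by the restriction of \<open>h(y\<^sup>-\<^sup>1 z)\<close> to \<open>y = z\<close>, which is
  \<open>h(1) = 0\<close>. The commutator with \<open>d\<^sub>j\<close> differentiates in \<open>y\<close> and in \<open>z\<close>, and the two
  contributions have opposite signs.
\<close>

lemma theta_commutes_Dn: "theta Y * Dn_rep d = Dn_rep d * theta Y"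
proof (induction Y rule: mDelta_induct)
  case (reduced i h)
  let ?X = "smash_vf i (translate (- 1) h)"
  have A: "?X * smash_of_A f = smash_of_A f * ?X" for f
    by (simp add: smash_vf_A An_mult_translate reduced S_simps)
  have d: "?X * smash_of_g (vf 1 j) = smash_of_g (vf 1 j) * ?X" for j
    by (simp add: d_smash_vf dd_left_translate dd_right_translate clinear_0[OF smash_vf_linear])
  have "?X * Dn_rep d = Dn_rep d * ?X"
  proof (induction d rule: Dn_induct)
    case (mult x y)
    have "?X * (Dn_rep x * Dn_rep y) = (Dn_rep x * ?X) * Dn_rep y"
      by (simp only: mult(1) flip: mult.assoc)
    then show ?case by (simp add: mult(2) algebra_homD[OF Dn_rep_hom] mult.assoc)
  qed (simp_all add: A d algebra_homD[OF Dn_rep_hom] distrib_left distrib_right mult_scaleC_left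
      mult_scaleC_right)
  then show ?case by (simp add: theta_reduced reduced)
qed (simp add: clinear_add[OF theta_linear] distrib_left distrib_right)

lemma theta_lie: "theta (lie X Y) = theta X * theta Y - theta Y * theta X"
proof (induction X rule: mDelta_induct)
  case (reduced i h)
  note h = reduced
  show ?case
  proof (induction Y rule: mDelta_induct)
    case (reduced j k)
    have "theta (reduced i h) * theta (reduced j k) - theta (reduced j k) * theta (reduced i h)
        = smash_vf j (translate (- 1) (h * dd i k)) - smash_vf i (translate (- 1) (k * dd j h))"
      by (simp add: theta_reduced h reduced smash_vf_lie An_mult_translate dd_right_translate
          translate_mult clinear_0[OF smash_vf_linear])
    then show ?case
      by (simp add: lie_reduced h reduced clinear_diff[OF theta_linear] theta_reduced counit_mult)
  qed (simp add: lie_add_right clinear_add[OF theta_linear] algebra_simps)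
qed (simp add: lie_add_left clinear_add[OF theta_linear] algebra_simps)

lemma theta_lie_hom: "lie_hom theta"
  by (simp add: lie_hom_def theta_linear theta_lie)

lemma tensor_lift_hom:
  fixes \<alpha> :: "'a::complex_algebra \<Rightarrow> 'c::complex_algebra" and \<beta> :: "'b::complex_algebra \<Rightarrow> 'c"
  assumes \<alpha>: "algebra_hom \<alpha>" and \<beta>: "algebra_hom \<beta>" and comm: "\<And>x y. \<beta> y * \<alpha> x = \<alpha> x * \<beta> y"
  shows "algebra_hom (tensor_lift (\<lambda>x y. \<alpha> x * \<beta> y))"
    and "tensor_lift (\<lambda>x y. \<alpha> x * \<beta> y) (x \<otimes>\<^sub>t y) = \<alpha> x * \<beta> y"
proof -
  note D = algebra_homD[OF \<alpha>] algebra_homD[OF \<beta>]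
  have bil: "cbilinear (\<lambda>x y. \<alpha> x * \<beta> y)"
    by (rule cbilinear_comp[OF D(1,8) cbilinear_times])
  note F = tensor_lift_tensor[OF bil] tensor_lift_add[OF bil] tensor_lift_scaleC[OF bil]
  let ?F = "tensor_lift (\<lambda>x y. \<alpha> x * \<beta> y)"
  have "?F (s * t) = ?F s * ?F t" for s t
  proof (rule bilinear_ext[where B = "\<lambda>s t. ?F (s * t)" and C = "\<lambda>s t. ?F s * ?F t"])
    fix f h :: 'a and g k :: 'b
    have "\<alpha> f * \<alpha> h * (\<beta> g * \<beta> k) = \<alpha> f * (\<beta> g * \<alpha> h) * \<beta> k"
      unfolding comm by (simp only: mult.assoc)
    then show "?F ((f \<otimes>\<^sub>t g) * (h \<otimes>\<^sub>t k)) = ?F (f \<otimes>\<^sub>t g) * ?F (h \<otimes>\<^sub>t k)"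
      by (simp add: tensor_mult F D mult.assoc)
  qed (simp_all only: distrib_left distrib_right F)
  then show "algebra_hom ?F"
    unfolding algebra_hom_def
    by (auto simp: tensor_lift_linear[OF bil] one_ctensor_def F D)
  show "?F (x \<otimes>\<^sub>t y) = \<alpha> x * \<beta> y"
    by (rule F)
qed

lemma uea_theta_commutes_Dn: "uea_lift theta u * Dn_rep d = Dn_rep d * uea_lift theta u"
proof (induction u rule: uea_induct)
  case (mult Y u)
  have "theta Y * (uea_lift theta u * Dn_rep d) = (theta Y * Dn_rep d) * uea_lift theta u"
    unfolding mult by (simp only: mult.assoc)
  then show ?case
    by (simp add: algebra_homD[OF uea_lift_hom[OF theta_lie_hom]] uea_lift_of[OF theta_lie_hom]
        theta_commutes_Dn mult.assoc)
qed (simp_all add: algebra_homD[OF uea_lift_hom[OF theta_lie_hom]] distrib_left distrib_right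
    mult_scaleC_left mult_scaleC_right)

definition psi :: "('n::finite Dn, 'n mDelta uea) ctensor \<Rightarrow> 'n smash"
  where "psi = tensor_lift (\<lambda>d u. Dn_rep d * uea_lift theta u)"

lemma psi_hom: "algebra_hom psi"
  and psi_tensor: "psi (d \<otimes>\<^sub>t u) = Dn_rep d * uea_lift theta u"
  unfolding psi_def
  by (rule tensor_lift_hom[OF Dn_rep_hom uea_lift_hom[OF theta_lie_hom] uea_theta_commutes_Dn])+

text \<open>
  Up to terms involving only \<open>D\<^sub>n\<close>, \<open>psi\<close> is the substitution \<open>z \<mapsto> y\<^sup>-\<^sup>1 z\<close> in the coefficient, and \<open>phi\<close>
  is the substitution \<open>z \<mapsto> y z\<close> (\<open>phi_smash_vf\<close> below).
\<close>

lemma psi_phi_red: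
  "psi (phi_red i w)
    = smash_vf i (shear (- 1) w) - smash_of_A (counit_right w) * smash_of_g (vf 1 i)"
  by (induction w rule: ctensor_induct)
    (simp_all add: phi_red_tensor psi_tensor uea_lift_of[OF theta_lie_hom] theta_reduced An2_tensor
      smash_vf_left_mult right_diff_distrib S_simps mult_scaleC_left mult_scaleC_right
      phi_red_add An2_add smash_vf_add algebra_homD[OF psi_hom] distrib_right)

text \<open>
  On \<open>f d\<^sub>i\<close> the substitutions \<open>f(y z)\<close> and \<open>z \<mapsto> y\<^sup>-\<^sup>1 z\<close> cancel, and the subtracted value at the
  neutral element cancels the summand \<open>f \<cdot> d\<^sub>i\<close>.
\<close>

lemma psi_phi: "psi (phi s) = s"
proof (rule smash_hom_eqI[of "\<lambda>s. psi (phi s)" "\<lambda>s. s"])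
  note h = algebra_homD[OF psi_hom] algebra_homD[OF phi_hom]
  note u = algebra_homD[OF uea_lift_hom[OF theta_lie_hom]]
  show "algebra_hom (\<lambda>s. psi (phi s))" "algebra_hom (\<lambda>s :: 'a smash. s)"
    unfolding algebra_hom_def by (auto intro!: clinearI simp: h)
  fix f :: "'a An" and i
  show "psi (phi (smash_of_A f)) = smash_of_A f"
    by (simp add: phi_A psi_tensor u)
  have "psi (phi_red i (translate 1 f))
      = smash_vf i (1 \<otimes>\<^sub>t f) - smash_of_A f * smash_of_g (vf 1 i)"
    by (simp add: psi_phi_red shear_translate translate_0 counit_right_translate)
  then show "psi (phi (smash_of_g (vf f i))) = smash_of_g (vf f i)"
    by (simp add: phi_of_g phi_g_vf h psi_tensor u smash_vf_tensor S_simps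
        algebra_homD[OF Dn_rep_hom])
qed

lemma phi_smash_vf:
  "phi (smash_vf i w) = phi_red i (shear 1 w) + (Dn_of_A (An_mult w) * Dn_d i) \<otimes>\<^sub>t 1"
  by (induction w rule: ctensor_induct)
    (simp_all add: smash_vf_tensor algebra_homD[OF phi_hom] phi_A phi_of_g phi_g_vf An2_tensor
      phi_red_left_mult distrib_left distrib_right tensor_mult A_simps mult.assoc smash_vf_add
      An2_add phi_red_add tensor_add_left)

lemma phi_theta: "phi (theta Y) = 1 \<otimes>\<^sub>t uea_of Y"
proof (induction Y rule: mDelta_induct)
  case (reduced i h)
  then show ?case
    by (simp add: theta_reduced phi_smash_vf shear_translate translate_0 An_mult_translate
        phi_red_tensor A_simps)
qed (simp add: clinear_add[OF theta_linear] algebra_homD[OF phi_hom] uea_of_simps tensor_add_right)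

lemma phi_psi: "phi (psi t) = t"
proof (induction t rule: ctensor_induct)
  case (tensor d u)
  have "phi (uea_lift theta u) = 1 \<otimes>\<^sub>t u"
    by (induction u rule: uea_induct)
      (simp_all add: algebra_homD[OF uea_lift_hom[OF theta_lie_hom]] algebra_homD[OF phi_hom]
        uea_lift_of[OF theta_lie_hom] phi_theta one_ctensor_def tensor_mult tensor_add_right
        tensor_scaleC_right)
  then show ?case
    by (simp add: psi_tensor algebra_homD[OF phi_hom] phi_Dn tensor_mult)
qed (simp add: algebra_homD[OF psi_hom] algebra_homD[OF phi_hom])

theorem theorem4p5:
  shows "\<exists>\<phi> :: 'n::finite smash \<Rightarrow> ('n Dn, 'n mDelta uea) ctensor.
    algebra_iso \<phi> \<and>
    (\<forall>a m i. \<phi> (smash_of_g (vf (tx a m) i)) =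
      (\<Sum>r\<in>{r. \<forall>j. r j \<le> m j}.
        of_nat (\<Prod>j\<in>UNIV. m j choose r j) *\<^sub>C
          (Dn_of_A (tx a (\<lambda>j. m j - r j)) \<otimes>\<^sub>t
            uea_of (mDelta_abs (vf (tx a r) i - (if r = 0 then vf 1 i else 0)))))
      + (Dn_of_A (tx a m) * Dn_d i) \<otimes>\<^sub>t 1) \<and>
    (\<forall>i. \<phi> (smash_of_g (vf 1 i)) = Dn_d i \<otimes>\<^sub>t 1) \<and>
    (\<forall>a m. \<phi> (smash_of_A (tx a m)) = Dn_of_A (tx a m) \<otimes>\<^sub>t 1)"
proof (intro exI[of _ phi] conjI allI)
  have "bij (phi :: 'n smash \<Rightarrow> _)"
    by (rule bijI') (metis psi_phi, metis phi_psi)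
  then show "algebra_iso (phi :: 'n smash \<Rightarrow> _)"
    by (simp add: algebra_iso_def algebra_homD[OF phi_hom])
  show "phi (smash_of_g (vf (tx a m) i)) =
      (\<Sum>r\<in>{r. \<forall>j. r j \<le> m j}.
        of_nat (\<Prod>j\<in>UNIV. m j choose r j) *\<^sub>C
          (Dn_of_A (tx a (\<lambda>j. m j - r j)) \<otimes>\<^sub>t
            uea_of (mDelta_abs (vf (tx a r) i - (if r = 0 then vf 1 i else 0)))))
      + (Dn_of_A (tx a m) * Dn_d i) \<otimes>\<^sub>t 1" for a m and i :: 'n
    by (simp only: phi_of_g phi_g_vf translate_binomial clinear_sum[OF phi_red_linear]
        phi_red_scaleC phi_red_tensor reduced_tx)
qed (simp_all only: phi_of_g phi_g_d phi_A)

end
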